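(* Let $K$ be a field whose characteristic is not $3$, let $n\geq 2$, and let $V=H^{0}(\mathbf{P}^{n}_{K},\mathcal{O}_{\mathbf{P}^{n}}(1))$. For a cubic form $F\in\mathrm{Sym}^{3}V$, let $X_F\subset\mathbf{P}^{n}$ be the hypersurface defined by $F$ and let $Y_{F,3}$ be the scheme of pairs $(p,L)$, with $L$ a line in $\mathbf{P}^{n}$ and $p$ a point of $L$, such that $L$ intersects $X_F$ at $p$ with multiplicity $\geq 3$ (with its scheme structure as defined in the context). Then $Y_{F,3}$ is smooth of dimension $2n-4$ if and only if $X_{F}$ is a smooth hypersurface in $\mathbf{P}^{n}$.
   Context: Let $V=H^{0}(\mathbf{P}^{n},\mathcal{O}_{\mathbf{P}^{n}}(1))$, so that an element $F\in\mathrm{Sym}^{d}V$ is a homogeneous polynomial of degree $d$ in $x_0,\dots,x_n$ over $K$. Let $\mathbf{P}=\mathrm{Grass}(n,V)$ be the Grassmannian of $n$-dimensional subspaces of $V$, identified with $\mathbf{P}^{n}$, with universal quotient bundle $\mathcal{Q}_{\mathbf{P}}=\mathcal{O}_{\mathbf{P}^{n}}(1)$. Let $\mathbf{G}=\mathrm{Grass}(n-1,V)$ be the Grassmannian of $(n-1)$-dimensional subspaces of $V$, i.e. the variety of lines in $\mathbf{P}^{n}$, with universal quotient bundle $\mathcal{Q}_{\mathbf{G}}$ (of rank $2$). Let $\Gamma\subset\mathbf{P}\times\mathbf{G}$ be the flag variety of pairs $(p,L)$ with $p\in L$, with projections $\phi:\Gamma\to\mathbf{P}$ and $\pi:\Gamma\to\mathbf{G}$.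 Let $\mathcal{Q}_{\phi}$ be the line bundle on $\Gamma$ that is the kernel of the natural surjection $\pi^{*}\mathcal{Q}_{\mathbf{G}}\to\phi^{*}\mathcal{Q}_{\mathbf{P}}$. For $0\le m\le d$ let $\mathrm{Fil}^{m}\mathrm{Sym}^{d}\pi^{*}\mathcal{Q}_{\mathbf{G}}$ be the image of the natural homomorphism $\mathrm{Sym}^{m}\mathcal{Q}_{\phi}\otimes\mathrm{Sym}^{d-m}\pi^{*}\mathcal{Q}_{\mathbf{G}}\to\mathrm{Sym}^{d}\pi^{*}\mathcal{Q}_{\mathbf{G}}$. For $F\in\mathrm{Sym}^{d}V$, $Y_{F,m}$ is the closed subscheme of $\Gamma$ defined as the zeros of the section of $\mathrm{Sym}^{d}\pi^{*}\mathcal{Q}_{\mathbf{G}}/\mathrm{Fil}^{m}\mathrm{Sym}^{d}\pi^{*}\mathcal{Q}_{\mathbf{G}}$ that is the image of $F$ under $\mathrm{Sym}^{d}V\simeq H^{0}(\Gamma,\mathrm{Sym}^{d}\pi^{*}\mathcal{Q}_{\mathbf{G}})\to H^{0}(\Gamma,\mathrm{Sym}^{d}\pi^{*}\mathcal{Q}_{\mathbf{G}}/\mathrm{Fil}^{m}\mathrm{Sym}^{d}\pi^{*}\mathcal{Q}_{\mathbf{G}})$. Here $d=m=3$. Local description: choose a basis $(x_0,\dots,x_n)$ of $V$ and use the affine chart of $\Gamma$ with coordinates $(\xi_1,\dots,\xi_n,\zeta_2,\dots,\zeta_n)$, the corresponding pair being the point $p_\xi=(1:\xi_1:\dots:\xi_n)$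 and the line $L_{(\xi,\zeta)}$ defined by $(x_j-\xi_jx_0)-\zeta_j(x_1-\xi_1x_0)=0$ for $2\le j\le n$. In this chart $Y_{F,m}$ is defined by $f_0=\dots=f_{m-1}=0$, where $F(1,t+\xi_1,\zeta_2t+\xi_2,\dots,\zeta_nt+\xi_n)=\sum_{k=0}^{d}f_k(\xi,\zeta)t^k$. Smoothness is over $K$ (equivalently, can be checked over the algebraic closure $\bar K$). *)

theory Defs
  imports
    "HOL-Library.Poly_Mapping"
    "HOL-Combinatorics.Permutations"
    "HOL-Algebra.Algebraic_Closure_Type"
begin

text \<open>
  Polynomials over \<open>'a\<close> in variables indexed by \<open>'v\<close>; the monoid algebra structure is the one
  of \<^theory>\<open>HOL-Library.Poly_Mapping\<close>.
\<close>

type_synonym ('v, 'a) mpoly = "('v \<Rightarrow>\<^sub>0 nat) \<Rightarrow>\<^sub>0 'a"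

definition mconst :: "'a::zero \<Rightarrow> ('v, 'a) mpoly" where
  "mconst c = Poly_Mapping.single 0 c"

definition mvar :: "'v \<Rightarrow> ('v, 'a::zero_neq_one) mpoly" where
  "mvar v = Poly_Mapping.single (Poly_Mapping.single v 1) 1"

text \<open>The value at \<open>y\<close> in an algebra whose structure map is \<open>h\<close>.\<close>

definition meval :: "('a::zero \<Rightarrow> 'b::comm_semiring_1) \<Rightarrow> ('v \<Rightarrow> 'b) \<Rightarrow> ('v, 'a) mpoly \<Rightarrow> 'b" where
  "meval h y p = (\<Sum>m\<in>Poly_Mapping.keys p.
     h (Poly_Mapping.lookup p m) * (\<Prod>v\<in>Poly_Mapping.keys m. y v ^ Poly_Mapping.lookup m v))"

abbreviation eval_at :: "('v \<Rightarrow> 'a::comm_semiring_1) \<Rightarrow> ('v, 'a) mpoly \<Rightarrow> 'a" where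
  "eval_at \<equiv> meval (\<lambda>c. c)"

definition pdiff :: "'v \<Rightarrow> ('v, 'a::comm_semiring_1) mpoly \<Rightarrow> ('v, 'a) mpoly" where
  "pdiff v p = (\<Sum>m\<in>Poly_Mapping.keys p.
     Poly_Mapping.single (m - Poly_Mapping.single v 1)
       (of_nat (Poly_Mapping.lookup m v) * Poly_Mapping.lookup p m))"

definition polys_in :: "'v set \<Rightarrow> ('v, 'a::zero) mpoly set" where
  "polys_in S = {p. \<forall>m\<in>Poly_Mapping.keys p. Poly_Mapping.keys m \<subseteq> S}"

definition forms :: "nat \<Rightarrow> nat \<Rightarrow> (nat, 'a::zero) mpoly set" where
  "forms n d = {F \<in> polys_in {..n}. \<forall>m\<in>Poly_Mapping.keys F.
     (\<Sum>v\<in>Poly_Mapping.keys m. Poly_Mapping.lookup m v) = d}"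

definition gen_ideal :: "'v set \<Rightarrow> ('v, 'a::comm_ring_1) mpoly set \<Rightarrow> ('v, 'a) mpoly set" where
  "gen_ideal S G = {\<Sum>g\<in>G. c g * g | c. \<forall>g\<in>G. c g \<in> polys_in S}"

text \<open>
  Smoothness of relative dimension \<open>r\<close> at the rational point \<open>y\<close> of the closed subscheme \<open>V(I)\<close>
  of the affine space with coordinates \<open>S\<close>, in the form used by Bosch, Luetkebohmert and Raynaud
  (Neron Models, 2.2/3): in a neighbourhood of \<open>y\<close> the ideal is generated by
  \<open>card S - r\<close> elements whose differentials at \<open>y\<close> are linearly independent.  The polynomial \<open>h\<close>
  expresses that \<open>I\<close> and \<open>G\<close> generate the same ideal in the local ring at \<open>y\<close>.
\<close>

definition smooth_at ::
  "'v set \<Rightarrow> ('v, 'a::field) mpoly set \<Rightarrow> nat \<Rightarrow> ('v \<Rightarrow> 'a) \<Rightarrow> bool" where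
  "smooth_at S I r y \<longleftrightarrow>
     (\<exists>G. set G \<subseteq> I \<and> length G + r = card S
        \<and> (\<forall>f\<in>I. \<exists>h\<in>polys_in S. eval_at y h \<noteq> 0 \<and> h * f \<in> gen_ideal S (set G))
        \<and> (\<forall>c. (\<forall>s\<in>S. (\<Sum>i<length G. c i * eval_at y (pdiff s (G ! i))) = 0)
                \<longrightarrow> (\<forall>i<length G. c i = 0)))"

text \<open>
  A scheme over \<open>'a\<close> is given by an affine open covering, each member of which is a closed
  subscheme of an affine space: a pair \<open>(S, E)\<close> of a finite set of coordinates and a finite set of
  equations.  The gluing maps are not recorded, since smoothness is local.  Smoothness
  over \<open>'a\<close> is smoothness of the base change to the algebraic closure at all its closed points
  (the smooth locus is open).  As usual for relative dimension, the empty scheme is not excluded.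
\<close>

definition smooth_of_dim :: "nat \<Rightarrow> ('v set \<times> ('v, 'a::field) mpoly set) set \<Rightarrow> bool" where
  "smooth_of_dim r charts \<longleftrightarrow>
     (\<forall>(S, E)\<in>charts. let E' = Poly_Mapping.map to_ac ` E in
        \<forall>y. (\<forall>f\<in>E'. eval_at y f = 0) \<longrightarrow> smooth_at S (gen_ideal S E') r y)"

text \<open>The hypersurface \<open>X\<^sub>F\<close>, on the standard charts \<open>x\<^sub>i = 1\<close> of projective space.\<close>

definition X_charts :: "nat \<Rightarrow> (nat, 'a::field) mpoly \<Rightarrow> (nat set \<times> (nat, 'a) mpoly set) set" where
  "X_charts n F =
     {({..n} - {i}, {meval mconst (\<lambda>j. if j = i then 1 else mvar j) F}) | i. i \<le> n}"

datatype coord = Xi nat | Zeta nat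

definition flag_coords :: "nat \<Rightarrow> coord set" where
  "flag_coords n = Xi ` {1..n} \<union> Zeta ` {2..n}"

text \<open>
  The line through \<open>(1 : \<xi>\<^sub>1 : \<dots> : \<xi>\<^sub>n)\<close> is parametrised by
  \<open>t \<mapsto> (1, t + \<xi>\<^sub>1, \<zeta>\<^sub>2 t + \<xi>\<^sub>2, \<dots>, \<zeta>\<^sub>n t + \<xi>\<^sub>n)\<close>; its entries are polynomials in \<open>t\<close> with coefficients
  in the coordinate ring of the chart.
\<close>

definition line_param :: "nat \<Rightarrow> (coord, 'a::field) mpoly poly" where
  "line_param j = (if j = 0 then 1
     else if j = 1 then [:mvar (Xi 1), 1:]
     else [:mvar (Xi j), mvar (Zeta j):])"

text \<open>
  The coefficient \<open>f\<^sub>k\<close> of \<open>t\<^sup>k\<close> in the restriction of \<open>F\<close> to the line, in the chart belonging to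
  the basis obtained by reordering the coordinates with \<open>\<sigma>\<close>: the coordinate \<open>x\<^sub>j\<close> becomes
  number \<open>\<sigma> j\<close>.
\<close>

definition contact_coeff ::
  "(nat \<Rightarrow> nat) \<Rightarrow> (nat, 'a::field) mpoly \<Rightarrow> nat \<Rightarrow> (coord, 'a) mpoly" where
  "contact_coeff \<sigma> F k = poly.coeff (meval (\<lambda>c. [:mconst c:]) (\<lambda>j. line_param (\<sigma> j)) F) k"

text \<open>
  The scheme \<open>Y\<^sub>F\<^sub>,\<^sub>m\<close> of pairs \<open>(p, L)\<close>.  A pair lies in the chart of \<open>\<sigma>\<close> iff, in the reordered
  coordinates, \<open>p\<^sub>0 \<noteq> 0\<close> and \<open>L\<close> meets \<open>x\<^sub>0 = 0\<close> in a point with \<open>x\<^sub>1 \<noteq> 0\<close>; so the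
  charts of all permutations cover the flag variety.
\<close>

definition Y_charts ::
  "nat \<Rightarrow> (nat, 'a::field) mpoly \<Rightarrow> nat \<Rightarrow> (coord set \<times> (coord, 'a) mpoly set) set" where
  "Y_charts n F m =
     {(flag_coords n, contact_coeff \<sigma> F ` {..<m}) | \<sigma>. \<sigma> permutes {..n}}"

end

theory Submission
  imports Defs
begin

text \<open>
  Both schemes are examined at the points of their charts over the algebraic closure.  The
  number of equations of a chart is the codimension that the required dimension leaves, so that the
  chart is smooth at a zero when the differentials of the equations are linearly independent there (\<open>smooth_at_if_independent\<close>),
  and it is not smooth when one of these differentials vanishes
  (\<open>not_smooth_at_if_differential_zero\<close>).  For the hypersurface this gives the usual description:
  it fails to be smooth iff all partial derivatives of \<open>F\<close> vanish at some nonzero vector \<open>z\<close>;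
  Euler's identity, in which the degree \<open>3\<close> is invertible, then gives \<open>F(z) = 0\<close>
  (\<open>smooth_hypersurface_iff\<close>).  The contact scheme turns out to obey the same condition
  (\<open>smooth_contact_scheme_iff\<close>), and the theorem follows.

  A point of a chart of the contact scheme is a line \<open>t \<mapsto> p + t v\<close> through \<open>p\<close>.  Write
  \<open>F(p + t v) = \<Sum> f\<^sub>k t\<^sup>k\<close> and \<open>(\<partial>\<^sub>j F)(p + t v) = a\<^sub>j + b\<^sub>j t + e\<^sub>j t\<^sup>2\<close>.  By the chain rule the derivative of
  \<open>f\<^sub>k\<close> by \<open>\<xi>\<^sub>j\<close> is the coefficient of \<open>t\<^sup>k\<close> in \<open>(\<partial>\<^sub>j F)(p + t v)\<close>, and the derivative by \<open>\<zeta>\<^sub>j\<close> is the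
  coefficient of \<open>t\<^sup>k\<close> in \<open>t (\<partial>\<^sub>j F)(p + t v)\<close>.

  If \<open>p\<close> is a singular point of the hypersurface, then \<open>a = 0\<close>, so the differential of \<open>f\<^sub>0\<close> vanishes
  for every line through \<open>p\<close>.  It remains to find such a line with \<open>f\<^sub>0 = f\<^sub>1 = f\<^sub>2 = 0\<close>.  The first two
  equations hold automatically, and the third one asks for a zero \<open>v\<close> of a quadratic form in
  \<open>n \<ge> 2\<close> variables, which exists over an algebraically closed field (\<open>asymptotic_direction\<close>).

  Conversely, let \<open>c\<^sub>0 df\<^sub>0 + c\<^sub>1 df\<^sub>1 + c\<^sub>2 df\<^sub>2 = 0\<close> be a nontrivial relation at a point where
  \<open>f\<^sub>0 = f\<^sub>1 = f\<^sub>2 = 0\<close>.  It says that the vectors \<open>c\<^sub>0 a + c\<^sub>1 b + c\<^sub>2 e\<close> and \<open>c\<^sub>1 a + c\<^sub>2 b\<close> vanish in all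
  coordinates except those which the chart normalises; Euler's identity and the derivative of
  \<open>F(p + t v)\<close> by \<open>t\<close> extend this to all coordinates.  If \<open>c\<^sub>2 = 0\<close>, then \<open>a = 0\<close> and \<open>p\<close> is singular.
  Otherwise let \<open>c\<^sub>2 = 1\<close>; then \<open>b = - c\<^sub>1 a\<close> and \<open>e = (c\<^sub>1\<^sup>2 - c\<^sub>0) a\<close>, so the gradient of \<open>F\<close> at \<open>v + s p\<close>
  is \<open>(s\<^sup>2 - c\<^sub>1 s + c\<^sub>1\<^sup>2 - c\<^sub>0) a\<close>, and a root \<open>s\<close> gives a singular point on the line
  (\<open>singular_point_of_dependent_contact\<close>).
\<close>

section \<open>Polynomials as an algebra\<close>

lemma poly_mapping_induct [case_names zero add]:
  fixes p :: "'k \<Rightarrow>\<^sub>0 'c::comm_monoid_add"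
  assumes "P 0" and step: "\<And>k c q. P q \<Longrightarrow> P (Poly_Mapping.single k c + q)"
  shows "P p"
proof (induction p rule: update_induct)
  case const
  then show ?case using assms by simp
next
  case (update f a b)
  have "Poly_Mapping.update a b f = Poly_Mapping.single a b + f"
    by (rule poly_mapping_eqI)
      (use update in \<open>auto simp: lookup_update lookup_add lookup_single when_def in_keys_iff\<close>)
  then show ?case using step[OF update(3)] by simp
qed

lemma monomial_induct [case_names zero add]:
  fixes m :: "'v \<Rightarrow>\<^sub>0 nat"
  assumes "P 0" and step: "\<And>v q. P q \<Longrightarrow> P (Poly_Mapping.single v 1 + q)"
  shows "P m"
proof (induction m rule: poly_mapping_induct)
  case zero
  show ?case by fact
next
  case (add v k q)
  show ?case
  proof (induction k)
    case 0
    then show ?case using add by simp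
  next
    case (Suc k)
    have "Poly_Mapping.single v (Suc k) + q
        = Poly_Mapping.single v 1 + (Poly_Mapping.single v k + q)"
      by (simp add: single_add[symmetric] add.assoc[symmetric])
    then show ?case using step[OF Suc] by (simp only:)
  qed
qed

definition pmonom :: "('v \<Rightarrow> 'b::comm_semiring_1) \<Rightarrow> ('v \<Rightarrow>\<^sub>0 nat) \<Rightarrow> 'b" where
  "pmonom x m = (\<Prod>v\<in>Poly_Mapping.keys m. x v ^ Poly_Mapping.lookup m v)"

definition mdeg :: "('v \<Rightarrow>\<^sub>0 nat) \<Rightarrow> nat" where
  "mdeg m = (\<Sum>v\<in>Poly_Mapping.keys m. Poly_Mapping.lookup m v)"

lemma pmonom_superset:
  assumes "finite S" "Poly_Mapping.keys m \<subseteq> S"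
  shows "pmonom x m = (\<Prod>v\<in>S. x v ^ Poly_Mapping.lookup m v)"
  unfolding pmonom_def using assms
  by (intro prod.mono_neutral_left) (auto simp: in_keys_iff)

lemma mdeg_superset:
  assumes "finite S" "Poly_Mapping.keys m \<subseteq> S"
  shows "mdeg m = (\<Sum>v\<in>S. Poly_Mapping.lookup m v)"
  unfolding mdeg_def using assms
  by (intro sum.mono_neutral_left) (auto simp: in_keys_iff)

lemma pmonom_0 [simp]: "pmonom x 0 = 1"
  by (simp add: pmonom_def)

lemma mdeg_0 [simp]: "mdeg 0 = 0"
  by (simp add: mdeg_def)

lemma pmonom_single [simp]: "pmonom x (Poly_Mapping.single v k) = x v ^ k"
  by (subst pmonom_superset[of "{v}"]) auto

lemma mdeg_single [simp]: "mdeg (Poly_Mapping.single v k) = k"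
  by (subst mdeg_superset[of "{v}"]) auto

lemma pmonom_add: "pmonom x (a + b) = pmonom x a * pmonom x b"
proof -
  let ?S = "Poly_Mapping.keys a \<union> Poly_Mapping.keys b"
  have "Poly_Mapping.keys (a + b) \<subseteq> ?S"
    by (rule keys_add)
  then show ?thesis
    by (simp add: pmonom_superset[of ?S] lookup_add power_add prod.distrib)
qed

lemma mdeg_add: "mdeg (a + b) = mdeg a + mdeg b"
proof -
  let ?S = "Poly_Mapping.keys a \<union> Poly_Mapping.keys b"
  have "Poly_Mapping.keys (a + b) \<subseteq> ?S"
    by (rule keys_add)
  then show ?thesis
    by (simp add: mdeg_superset[of ?S] lookup_add sum.distrib)
qed

lemma meval_pmonom:
  "meval h x p = (\<Sum>m\<in>Poly_Mapping.keys p. h (Poly_Mapping.lookup p m) * pmonom x m)"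
  by (simp add: meval_def pmonom_def)

text \<open>
  Evaluation at a point, restriction to a line and dehomogenisation are all instances of
  \<^const>\<open>meval\<close> with different structure maps; the locale lets one computation serve them all.
\<close>

locale coeff_hom =
  fixes h :: "'a::comm_semiring_1 \<Rightarrow> 'b::comm_semiring_1"
  assumes hom_0 [simp]: "h 0 = 0" and hom_1 [simp]: "h 1 = 1"
    and hom_add: "h (a + b) = h a + h b" and hom_mult: "h (a * b) = h a * h b"
begin

lemma hom_sum: "h (sum f A) = (\<Sum>i\<in>A. h (f i))"
  by (induction A rule: infinite_finite_induct) (auto simp: hom_add)

lemma hom_prod: "h (prod f A) = (\<Prod>i\<in>A. h (f i))"
  by (induction A rule: infinite_finite_induct) (auto simp: hom_mult)

lemma hom_power: "h (a ^ k) = h a ^ k"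
  by (induction k) (auto simp: hom_mult)

lemma hom_of_nat [simp]: "h (of_nat k) = of_nat k"
  by (induction k) (auto simp: hom_add)

lemma hom_pmonom: "h (pmonom x m) = pmonom (\<lambda>v. h (x v)) m"
  by (simp add: pmonom_def hom_prod hom_power)

lemma meval_superset:
  assumes "finite M" "Poly_Mapping.keys p \<subseteq> M"
  shows "meval h x p = (\<Sum>m\<in>M. h (Poly_Mapping.lookup p m) * pmonom x m)"
  unfolding meval_pmonom using assms
  by (intro sum.mono_neutral_left) (auto simp: in_keys_iff)

lemma meval_0 [simp]: "meval h x 0 = 0"
  by (simp add: meval_def)

lemma meval_single [simp]: "meval h x (Poly_Mapping.single m c) = h c * pmonom x m"
  by (subst meval_superset[of "{m}"]) auto

lemma meval_mconst [simp]: "meval h x (mconst c) = h c"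
  by (simp add: mconst_def)

lemma meval_mvar [simp]: "meval h x (mvar v) = x v"
  by (simp add: mvar_def)

lemma meval_1 [simp]: "meval h x 1 = 1"
  unfolding single_one[symmetric] by (simp del: single_one)

lemma meval_add: "meval h x (p + q) = meval h x p + meval h x q"
proof -
  let ?M = "Poly_Mapping.keys p \<union> Poly_Mapping.keys q"
  have "Poly_Mapping.keys (p + q) \<subseteq> ?M"
    by (rule keys_add)
  then show ?thesis
    by (simp add: meval_superset[of ?M] lookup_add hom_add sum.distrib algebra_simps)
qed

lemma meval_mult: "meval h x (p * q) = meval h x p * meval h x q"
proof (induction p rule: poly_mapping_induct)
  case zero
  then show ?case by simp
next
  case (add k c p)
  have "meval h x (Poly_Mapping.single k c * q) = meval h x (Poly_Mapping.single k c) * meval h x q"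
    by (induction q rule: poly_mapping_induct)
      (simp_all add: distrib_left meval_add mult_single hom_mult pmonom_add mult_ac)
  then show ?case
    by (simp only: distrib_right meval_add add)
qed

lemma coeff_hom_meval: "coeff_hom (meval h x)"
  by standard (auto simp: meval_add meval_mult)

lemma coeff_hom_pCons: "coeff_hom (\<lambda>c. [:h c:])"
  by standard (auto simp: hom_add hom_mult one_pCons mult.commute)

lemma coeff_hom_map_poly: "coeff_hom (map_poly h)"
  by standard (auto intro!: poly_eqI simp: coeff_map_poly hom_add coeff_mult hom_mult hom_sum)

text \<open>
  Substitutions compose.  This is how the equations of a chart, which arise from \<open>F\<close> by
  substituting polynomials, are evaluated at a point.
\<close>

lemma hom_meval:
  assumes "coeff_hom g"
  shows "h (meval g x p) = meval (\<lambda>c. h (g c)) (\<lambda>v. h (x v)) p"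
  by (simp add: meval_pmonom hom_sum hom_mult hom_pmonom)

lemma lookup_map_hom: "Poly_Mapping.lookup (Poly_Mapping.map h p) m = h (Poly_Mapping.lookup p m)"
  by (auto simp: map.rep_eq when_def)

lemma eval_at_map: "eval_at y (Poly_Mapping.map h p) = meval h y p"
proof -
  have id: "coeff_hom (\<lambda>c::'b. c)"
    by standard auto
  have "Poly_Mapping.keys (Poly_Mapping.map h p) \<subseteq> Poly_Mapping.keys p"
    by (auto simp: in_keys_iff lookup_map_hom)
  then show ?thesis
    by (subst coeff_hom.meval_superset[OF id, of "Poly_Mapping.keys p"])
      (simp_all add: lookup_map_hom meval_pmonom)
qed

end

lemma coeff_hom_id: "coeff_hom (\<lambda>c. c)"
  by standard auto

lemma coeff_hom_poly: "coeff_hom (\<lambda>p. poly p s)"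
  by standard auto

lemma coeff_hom_mconst: "coeff_hom mconst"
  by standard (auto simp: mconst_def single_add mult_single)

lemma coeff_hom_to_ac: "coeff_hom to_ac"
  by standard auto

text \<open>
  Induction along the algebra structure, so that a statement compatible with sums and products
  has to be verified only for constants and for the variables that can occur.
\<close>

lemma polys_in_induct [consumes 1, case_names const var add mult]:
  fixes p :: "('v, 'a::comm_semiring_1) mpoly"
  assumes p: "p \<in> polys_in S"
    and const: "\<And>c. P (mconst c)" and var: "\<And>v. v \<in> S \<Longrightarrow> P (mvar v)"
    and add: "\<And>p q. P p \<Longrightarrow> P q \<Longrightarrow> P (p + q)" and mult: "\<And>p q. P p \<Longrightarrow> P q \<Longrightarrow> P (p * q)"
  shows "P p"
proof -
  interpret mconst: coeff_hom "mconst :: 'a \<Rightarrow> ('v, 'a) mpoly"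
    by (rule coeff_hom_mconst)
  have P1: "P 1" using const[of 1] by simp
  have pow: "P (q ^ k)" if "P q" for q k
    by (induction k) (use that P1 mult in auto)
  have prod: "P (prod f A)" if "\<And>i. i \<in> A \<Longrightarrow> P (f i)" for f :: "'v \<Rightarrow> ('v, 'a) mpoly" and A
    using that by (induction A rule: infinite_finite_induct) (use P1 mult in auto)
  have sum: "P (sum f A)" if "\<And>i. i \<in> A \<Longrightarrow> P (f i)" for f :: "_ \<Rightarrow> ('v, 'a) mpoly" and A
    using that const[of 0] by (induction A rule: infinite_finite_induct) (use add in auto)
  have single: "meval mconst mvar (Poly_Mapping.single m c) = Poly_Mapping.single m c"
    for m :: "'v \<Rightarrow>\<^sub>0 nat" and c :: 'a
  proof (induction m rule: monomial_induct)
    case zero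
    show ?case by simp (simp add: mconst_def)
  next
    case (add v q)
    have "Poly_Mapping.single (Poly_Mapping.single v 1 + q) c = mvar v * Poly_Mapping.single q c"
      by (simp add: mvar_def mult_single)
    then show ?case using add by (simp add: mconst.meval_mult)
  qed
  have "p = meval mconst mvar p"
    by (induction p rule: poly_mapping_induct) (simp_all add: mconst.meval_add single del: mconst.meval_single)
  moreover have "P (meval mconst mvar p)"
    unfolding meval_def using p
    by (intro sum mult const prod pow var) (auto simp: polys_in_def)
  ultimately show ?thesis by simp
qed

section \<open>Partial derivatives\<close>

lemma pdiff_superset:
  assumes "finite M" "Poly_Mapping.keys p \<subseteq> M"
  shows "pdiff v p = (\<Sum>m\<in>M. Poly_Mapping.single (m - Poly_Mapping.single v 1)
       (of_nat (Poly_Mapping.lookup m v) * Poly_Mapping.lookup p m))"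
  unfolding pdiff_def using assms
  by (intro sum.mono_neutral_left) (auto simp: in_keys_iff)

lemma pdiff_0 [simp]: "pdiff v 0 = 0"
  by (simp add: pdiff_def)

lemma pdiff_single: "pdiff v (Poly_Mapping.single m c) =
    Poly_Mapping.single (m - Poly_Mapping.single v 1) (of_nat (Poly_Mapping.lookup m v) * c)"
  by (subst pdiff_superset[of "{m}"]) auto

lemma pdiff_mconst [simp]: "pdiff v (mconst c) = 0"
  by (simp add: mconst_def pdiff_single)

lemma pdiff_1 [simp]: "pdiff v 1 = 0"
  using pdiff_mconst[of v 1] by (simp add: mconst_def)

lemma pdiff_mvar: "pdiff v (mvar w) = (if v = w then 1 else 0)"
  by (simp add: mvar_def pdiff_single lookup_single)

lemma pdiff_add: "pdiff v (p + q) = pdiff v p + pdiff v q"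
proof -
  let ?M = "Poly_Mapping.keys p \<union> Poly_Mapping.keys q"
  have "Poly_Mapping.keys (p + q) \<subseteq> ?M"
    by (rule keys_add)
  then show ?thesis
    by (simp add: pdiff_superset[of ?M] lookup_add sum.distrib distrib_left single_add)
qed

lemma pdiff_sum: "pdiff v (sum f A) = (\<Sum>i\<in>A. pdiff v (f i))"
  by (induction A rule: infinite_finite_induct) (auto simp: pdiff_add)

text \<open>
  Truncated subtraction of exponents is harmless, because the coefficient vanishes whenever the
  exponent of \<open>v\<close> is \<open>0\<close>.
\<close>

lemma pdiff_single_mult:
  "pdiff v (Poly_Mapping.single m c * Poly_Mapping.single m' c') =
     Poly_Mapping.single m c * pdiff v (Poly_Mapping.single m' c')
   + Poly_Mapping.single m' c' * pdiff v (Poly_Mapping.single m c)"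
proof -
  let ?e = "Poly_Mapping.single v 1"
  have shift: "Poly_Mapping.single (a + b - ?e) (of_nat (Poly_Mapping.lookup b v) * d)
      = Poly_Mapping.single (a + (b - ?e)) (of_nat (Poly_Mapping.lookup b v) * d)"
    for a b :: "'a \<Rightarrow>\<^sub>0 nat" and d :: 'b
  proof (cases "Poly_Mapping.lookup b v = 0")
    case False
    then have "a + b - ?e = a + (b - ?e)"
      by (intro poly_mapping_eqI) (auto simp: lookup_add lookup_minus lookup_single when_def)
    then show ?thesis by simp
  qed simp
  show ?thesis
    using shift[of m m' "c * c'"] shift[of m' m "c * c'"]
    by (simp add: mult_single pdiff_single lookup_add distrib_right single_add algebra_simps)
qed

lemma pdiff_mult: "pdiff v (p * q) = p * pdiff v q + q * pdiff v p"
proof (induction p rule: poly_mapping_induct)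
  case zero
  then show ?case by simp
next
  case (add k c p)
  have "pdiff v (Poly_Mapping.single k c * q) =
      Poly_Mapping.single k c * pdiff v q + q * pdiff v (Poly_Mapping.single k c)"
  proof (induction q rule: poly_mapping_induct)
    case zero
    then show ?case by simp
  next
    case (add k' c' q)
    then show ?case
      by (simp only: distrib_left distrib_right pdiff_add pdiff_single_mult) (simp add: algebra_simps)
  qed
  then show ?case
    by (simp only: distrib_left distrib_right pdiff_add add) (simp add: algebra_simps)
qed

lemma (in coeff_hom) pdiff_map:
  fixes p :: "('v, 'a) mpoly"
  shows "pdiff v (Poly_Mapping.map h p) = Poly_Mapping.map h (pdiff v p)"
proof (induction p rule: poly_mapping_induct)
  case zero
  have "Poly_Mapping.map h (0 :: ('v, 'a) mpoly) = 0"
    by (simp add: map_eq_zero_iff)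
  then show ?case by simp
next
  case (add m c p)
  have map_add: "Poly_Mapping.map h (p + q) = Poly_Mapping.map h p + Poly_Mapping.map h q"
    for p q :: "('v, 'a) mpoly"
    by (rule poly_mapping_eqI) (simp add: lookup_map_hom lookup_add hom_add)
  show ?case
    by (simp add: map_add pdiff_add add pdiff_single hom_mult)
qed

text \<open>
  A derivation along a homomorphism \<open>\<phi>\<close>, such as the derivative at a point, where \<open>\<phi>\<close> is evaluation
  there.  In a semiring, additivity does not give \<open>\<delta> 0 = 0\<close>, which is therefore required.
\<close>

locale derivation = coeff_hom \<phi> for \<phi> :: "'b::comm_semiring_1 \<Rightarrow> 'c::comm_semiring_1" +
  fixes \<delta> :: "'b \<Rightarrow> 'c"
  assumes der_0 [simp]: "\<delta> 0 = 0" and der_add: "\<delta> (a + b) = \<delta> a + \<delta> b"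
    and der_mult: "\<delta> (a * b) = \<phi> a * \<delta> b + \<phi> b * \<delta> a"
begin

lemma der_sum: "\<delta> (sum f A) = (\<Sum>i\<in>A. \<delta> (f i))"
  by (induction A rule: infinite_finite_induct) (auto simp: der_add)

text \<open>
  The equations of the contact scheme are coefficients of a polynomial in the line parameter;
  differentiating them all at once means differentiating that polynomial coefficientwise.
\<close>

lemma derivation_map_poly: "derivation (map_poly \<phi>) (map_poly \<delta>)"
proof -
  interpret p: coeff_hom "map_poly \<phi>"
    by (rule coeff_hom_map_poly)
  have "map_poly \<delta> (a * b) = map_poly \<phi> a * map_poly \<delta> b + map_poly \<phi> b * map_poly \<delta> a" for a b
  proof (rule poly_eqI)
    fix k
    have "poly.coeff (map_poly \<delta> (a * b)) k
        = poly.coeff (map_poly \<phi> a * map_poly \<delta> b + map_poly \<delta> a * map_poly \<phi> b) k"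
      by (simp add: coeff_map_poly coeff_mult der_sum der_mult sum.distrib)
        (simp add: mult.commute[of "\<phi> (poly.coeff b _)"])
    then show "poly.coeff (map_poly \<delta> (a * b)) k
        = poly.coeff (map_poly \<phi> a * map_poly \<delta> b + map_poly \<phi> b * map_poly \<delta> a) k"
      by (simp only: mult.commute)
  qed
  then show ?thesis
    by unfold_locales (auto intro!: poly_eqI simp: coeff_map_poly der_add)
qed

text \<open>
  Both sides are derivations in \<open>p\<close> along evaluation at \<open>\<phi> \<circ> x\<close>, and they agree on constants and
  variables.
\<close>

lemma chain_rule:
  assumes g: "coeff_hom g" and const: "\<And>c. \<delta> (g c) = 0"
    and "finite S" and "p \<in> polys_in S"
  shows "\<delta> (meval g x p) =
    (\<Sum>j\<in>S. meval (\<lambda>c. \<phi> (g c)) (\<lambda>v. \<phi> (x v)) (pdiff j p) * \<delta> (x j))"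
proof -
  interpret g: coeff_hom g by fact
  interpret c: coeff_hom "\<lambda>c. \<phi> (g c)"
    by standard (simp_all add: g.hom_add g.hom_mult hom_add hom_mult)
  show ?thesis
    using \<open>p \<in> polys_in S\<close>
  proof (induction p rule: polys_in_induct)
    case (const c)
    then show ?case by (simp add: assms(2))
  next
    case (var v)
    have "(\<Sum>j\<in>S. meval (\<lambda>c. \<phi> (g c)) (\<lambda>v. \<phi> (x v)) (pdiff j (mvar v)) * \<delta> (x j))
        = (\<Sum>j\<in>S. if j = v then \<delta> (x j) else 0)"
      by (intro sum.cong) (auto simp: pdiff_mvar)
    then show ?case using var \<open>finite S\<close> by simp
  next
    case (add p q)
    then show ?case
      by (simp add: g.meval_add der_add pdiff_add c.meval_add distrib_right sum.distrib)
  next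
    case (mult p q)
    then show ?case
      by (simp add: g.meval_mult der_mult pdiff_mult c.meval_mult c.meval_add hom_meval[OF g]
          distrib_right sum.distrib sum_distrib_left mult.assoc)
  qed
qed

end

lemma (in coeff_hom) derivation_meval: "derivation (meval h y) (\<lambda>p. meval h y (pdiff s p))"
proof -
  interpret m: coeff_hom "meval h y"
    by (rule coeff_hom_meval)
  show ?thesis
    by unfold_locales (simp_all add: pdiff_add pdiff_mult m.hom_add m.hom_mult)
qed

lemma derivation_pderiv:
  "derivation (\<lambda>p. p) (pderiv :: 'a::{comm_semiring_1,semiring_no_zero_divisors} poly \<Rightarrow> 'a poly)"
  by unfold_locales (auto simp: pderiv_add pderiv_mult)

section \<open>Forms\<close>

lemma forms_iff:
  "F \<in> forms n d \<longleftrightarrow> F \<in> polys_in {..n} \<and> (\<forall>m\<in>Poly_Mapping.keys F. mdeg m = d)"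
  by (simp add: forms_def mdeg_def)

lemma diff_single_add:
  fixes m :: "'v \<Rightarrow>\<^sub>0 nat"
  assumes "Poly_Mapping.lookup m v \<noteq> 0"
  shows "Poly_Mapping.single v 1 + (m - Poly_Mapping.single v 1) = m"
  by (rule poly_mapping_eqI)
    (use assms in \<open>auto simp: lookup_add lookup_minus lookup_single when_def\<close>)

lemma pdiff_forms:
  assumes "F \<in> forms n (Suc d)"
  shows "pdiff j F \<in> forms n d"
proof -
  have "Poly_Mapping.keys m' \<subseteq> {..n} \<and> mdeg m' = d"
    if mem: "m' \<in> Poly_Mapping.keys (pdiff j F)" for m'
  proof -
    obtain m where m: "m \<in> Poly_Mapping.keys F" "m' = m - Poly_Mapping.single j 1"
      and "of_nat (Poly_Mapping.lookup m j) * Poly_Mapping.lookup F m \<noteq> 0"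
      using subsetD[OF keys_sum mem[unfolded pdiff_def]] by (auto split: if_splits)
    then have "Poly_Mapping.lookup m j \<noteq> 0"
      by (metis mult_zero_left of_nat_0)
    then have "m = Poly_Mapping.single j 1 + m'"
      using m(2) diff_single_add by metis
    then have "mdeg m = Suc (mdeg m')"
      by (simp add: mdeg_add)
    moreover have "Poly_Mapping.keys m' \<subseteq> Poly_Mapping.keys m"
      unfolding m(2) by (auto simp: in_keys_iff lookup_minus)
    ultimately show ?thesis
      using assms m(1) by (auto simp: forms_iff polys_in_def)
  qed
  then show ?thesis
    by (auto simp: forms_iff polys_in_def)
qed

lemma meval_scale:
  assumes "F \<in> forms n d"
  shows "meval h (\<lambda>j. s * x j) F = s ^ d * meval h x F"
proof -
  have "pmonom (\<lambda>j. s * x j) m = s ^ mdeg m * pmonom x m" for m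
    by (induction m rule: monomial_induct)
      (simp_all add: pmonom_add mdeg_add mult_ac del: pmonom_single, simp_all add: mult_ac)
  then show ?thesis
    using assms by (simp add: meval_pmonom forms_iff sum_distrib_left mult_ac)
qed

text \<open>
  Multiplying the \<open>j\<close>-th derivative of a monomial by its variable returns the monomial times its
  exponent at \<open>j\<close>, and the exponents add up to the degree.
\<close>

lemma (in coeff_hom) euler_identity:
  assumes "F \<in> forms n d"
  shows "(\<Sum>j\<le>n. x j * meval h x (pdiff j F)) = of_nat d * meval h x F"
proof -
  interpret m: coeff_hom "meval h x"
    by (rule coeff_hom_meval)
  have monom: "x j * (of_nat (Poly_Mapping.lookup m j) * pmonom x (m - Poly_Mapping.single j 1))
      = of_nat (Poly_Mapping.lookup m j) * pmonom x m" for j m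
  proof (cases "Poly_Mapping.lookup m j = 0")
    case False
    have "pmonom x m = x j * pmonom x (m - Poly_Mapping.single j 1)"
      by (subst diff_single_add[OF False, symmetric]) (simp only: pmonom_add pmonom_single power_one_right)
    then show ?thesis by (simp add: mult_ac)
  qed simp
  have "x j * meval h x (pdiff j F) = (\<Sum>m\<in>Poly_Mapping.keys F.
      h (Poly_Mapping.lookup F m) * (of_nat (Poly_Mapping.lookup m j) * pmonom x m))" for j
    unfolding pdiff_def m.hom_sum sum_distrib_left monom[symmetric]
    by (intro sum.cong refl) (simp add: hom_mult mult_ac)
  then have "(\<Sum>j\<le>n. x j * meval h x (pdiff j F)) = (\<Sum>m\<in>Poly_Mapping.keys F. \<Sum>j\<le>n.
      h (Poly_Mapping.lookup F m) * (of_nat (Poly_Mapping.lookup m j) * pmonom x m))"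
    by (simp add: sum.swap[of _ "{..n}"])
  also have "\<dots> = (\<Sum>m\<in>Poly_Mapping.keys F. of_nat d * (h (Poly_Mapping.lookup F m) * pmonom x m))"
  proof (intro sum.cong refl)
    fix m assume m: "m \<in> Poly_Mapping.keys F"
    then have "(\<Sum>j\<le>n. Poly_Mapping.lookup m j) = d"
      using assms mdeg_superset[of "{..n}" m] by (auto simp: forms_iff polys_in_def)
    then have "(\<Sum>j\<le>n. of_nat (Poly_Mapping.lookup m j)) = (of_nat d :: 'b)"
      by (metis of_nat_sum)
    then show "(\<Sum>j\<le>n. h (Poly_Mapping.lookup F m) * (of_nat (Poly_Mapping.lookup m j) * pmonom x m))
        = of_nat d * (h (Poly_Mapping.lookup F m) * pmonom x m)"
      by (simp add: sum_distrib_left[symmetric] sum_distrib_right[symmetric] mult_ac)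
  qed
  also have "\<dots> = of_nat d * meval h x F"
    by (simp add: meval_pmonom sum_distrib_left)
  finally show ?thesis .
qed

section \<open>Restriction of a form to a parametrised line\<close>

definition line_restr ::
  "('a::zero \<Rightarrow> 'b::field) \<Rightarrow> ('v \<Rightarrow> 'b) \<Rightarrow> ('v \<Rightarrow> 'b) \<Rightarrow> ('v, 'a) mpoly \<Rightarrow> 'b poly" where
  "line_restr h p v G = meval (\<lambda>c. [:h c:]) (\<lambda>j. [:p j, v j:]) G"

locale coeff_hom_field = coeff_hom h for h :: "'a::comm_semiring_1 \<Rightarrow> 'b::field"
begin

interpretation C: coeff_hom "\<lambda>c. [:h c:]"
  by (rule coeff_hom_pCons)

lemma poly_line_restr: "poly (line_restr h p v G) s = meval h (\<lambda>j. p j + s * v j) G"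
  unfolding line_restr_def
  by (subst coeff_hom.hom_meval[OF coeff_hom_poly C.coeff_hom_axioms]) simp

lemma coeff_0_line_restr: "poly.coeff (line_restr h p v G) 0 = meval h p G"
  using poly_line_restr[of p v G 0] by (simp add: poly_0_coeff_0)

lemma pderiv_line_restr:
  assumes "finite S" "G \<in> polys_in S"
  shows "pderiv (line_restr h p v G) = (\<Sum>j\<in>S. line_restr h p v (pdiff j G) * [:v j:])"
  unfolding line_restr_def
  by (subst derivation.chain_rule[OF derivation_pderiv C.coeff_hom_axioms _ assms])
    (simp_all add: pderiv_pCons)

lemma euler_line_restr:
  assumes "G \<in> forms n d"
  shows "(\<Sum>j\<le>n. [:p j, v j:] * line_restr h p v (pdiff j G)) = of_nat d * line_restr h p v G"
  unfolding line_restr_def by (rule C.euler_identity) fact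

lemma degree_pmonom_line:
  "Polynomial.degree (pmonom (\<lambda>j. [:p j, v j :: 'b:]) m) \<le> mdeg m"
proof (induction m rule: monomial_induct)
  case (add w m)
  have "Polynomial.degree ([:p w, v w:] * pmonom (\<lambda>j. [:p j, v j:]) m)
      \<le> Polynomial.degree [:p w, v w:] + Polynomial.degree (pmonom (\<lambda>j. [:p j, v j:]) m)"
    by (rule degree_mult_le)
  also have "\<dots> \<le> 1 + mdeg m"
    using add by (intro add_mono) auto
  finally show ?case
    by (simp add: pmonom_add mdeg_add del: mult_pCons_left)
qed simp

text \<open>
  Exchanging \<open>p\<close> and \<open>v\<close> replaces the linear factors \<open>p\<^sub>j + t v\<^sub>j\<close> by \<open>v\<^sub>j + t p\<^sub>j\<close>, and hence reverses the
  coefficients of their product.  The reversal is relative to the formal degree, since some \<open>v\<^sub>j\<close> may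
  vanish.
\<close>

lemma coeff_pmonom_line_reverse:
  assumes "k \<le> mdeg m"
  shows "poly.coeff (pmonom (\<lambda>j. [:p j, v j :: 'b:]) m) k
       = poly.coeff (pmonom (\<lambda>j. [:v j, p j:]) m) (mdeg m - k)"
  using assms
proof (induction m arbitrary: k rule: monomial_induct)
  case zero
  then show ?case by simp
next
  case (add w m)
  let ?A = "pmonom (\<lambda>j. [:p j, v j:]) m" and ?B = "pmonom (\<lambda>j. [:v j, p j:]) m"
  have k: "k \<le> Suc (mdeg m)"
    using add.prems by (simp add: mdeg_add)
  have A0: "poly.coeff ?A (Suc (mdeg m)) = 0" and B0: "poly.coeff ?B (Suc (mdeg m)) = 0"
    using degree_pmonom_line[of p v m] degree_pmonom_line[of v p m]
    by (auto intro!: coeff_eq_0)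
  have "poly.coeff ([:p w, v w:] * ?A) k = poly.coeff ([:v w, p w:] * ?B) (Suc (mdeg m) - k)"
  proof (cases k)
    case 0
    then show ?thesis
      using add.IH[of 0] B0 by simp
  next
    case (Suc k')
    then have k': "k' \<le> mdeg m" using k by simp
    show ?thesis
    proof (cases "k' = mdeg m")
      case True
      then show ?thesis
        using add.IH[of "mdeg m"] A0 Suc by simp
    next
      case False
      then have "mdeg m - k' = Suc (mdeg m - Suc k')" "Suc k' \<le> mdeg m"
        using k' by auto
      then show ?thesis
        using add.IH[of k'] add.IH[of "Suc k'"] Suc k' by (simp add: add.commute)
    qed
  qed
  then show ?case
    by (simp add: pmonom_add mdeg_add del: mult_pCons_left)
qed

lemma degree_line_restr:
  assumes "G \<in> forms n d"
  shows "Polynomial.degree (line_restr h p v G) \<le> d"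
  unfolding line_restr_def meval_pmonom
proof (intro degree_sum_le)
  fix m assume "m \<in> Poly_Mapping.keys G"
  then have "mdeg m = d" using assms by (simp add: forms_iff)
  then show "Polynomial.degree ([:h (Poly_Mapping.lookup G m):] * pmonom (\<lambda>j. [:p j, v j:]) m) \<le> d"
    using degree_pmonom_line[of p v m] by simp
qed simp

text \<open>
  This gives access to the point at infinity \<open>v\<close> of the line: the gradient along \<open>v + s p\<close>, and
  in particular at \<open>v\<close>, is read off from the coefficients of the gradient along \<open>p + t v\<close>.
\<close>

lemma coeff_line_restr_reverse:
  assumes "G \<in> forms n d" "k \<le> d"
  shows "poly.coeff (line_restr h p v G) k = poly.coeff (line_restr h v p G) (d - k)"
proof -
  have "poly.coeff (pmonom (\<lambda>j. [:p j, v j:]) m) k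
      = poly.coeff (pmonom (\<lambda>j. [:v j, p j:]) m) (d - k)" if "m \<in> Poly_Mapping.keys G" for m
    using that assms coeff_pmonom_line_reverse[of k m p v] by (auto simp: forms_iff)
  then show ?thesis
    by (simp add: line_restr_def meval_pmonom coeff_sum)
qed

text \<open>
  After reversal the coefficient is the one of \<open>s\<close> in \<open>F(v + s p)\<close>, the derivative of \<open>F\<close> at \<open>v\<close> in
  the direction \<open>p\<close>.  So it is a quadratic form in \<open>v\<close>, the polar quadric of \<open>p\<close>.
\<close>

lemma coeff_2_line_restr_cubic:
  assumes "F \<in> forms n 3"
  shows "poly.coeff (line_restr h p v F) 2 = (\<Sum>j\<le>n. p j * meval h v (pdiff j F))"
proof -
  have "poly.coeff (line_restr h p v F) 2 = poly.coeff (line_restr h v p F) 1"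
    using coeff_line_restr_reverse[OF assms, of 2] by simp
  also have "\<dots> = poly.coeff (pderiv (line_restr h v p F)) 0"
    by (simp add: coeff_pderiv)
  also have "\<dots> = (\<Sum>j\<le>n. p j * meval h v (pdiff j F))"
    using assms by (subst pderiv_line_restr[of "{..n}"])
      (auto simp: forms_iff coeff_sum coeff_0_line_restr coeff_mult_0)
  finally show ?thesis .
qed

end

locale coeff_hom_alg_closed = coeff_hom_field h for h :: "'a::comm_semiring_1 \<Rightarrow> 'b::alg_closed_field"
begin

text \<open>
  The polar quadric of \<open>p\<close> meets the line spanned by \<open>u\<close> and \<open>w\<close>: on \<open>w + s u\<close> it is a polynomial in
  \<open>s\<close> whose coefficient of \<open>s\<^sup>2\<close> is its value at \<open>u\<close>.  Either this value is \<open>0\<close>, or the polynomial is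
  nonconstant and has a root.
\<close>

lemma asymptotic_direction:
  assumes F: "F \<in> forms n 3"
  obtains "poly.coeff (line_restr h p u F) 2 = 0"
  | s where "poly.coeff (line_restr h p (\<lambda>j. w j + s * u j) F) 2 = 0"
proof (cases "poly.coeff (line_restr h p u F) 2 = 0")
  case False
  define R where "R = (\<Sum>j\<le>n. [:p j:] * line_restr h w u (pdiff j F))"
  have pF: "pdiff j F \<in> forms n 2" for j
    using F by (intro pdiff_forms) (simp add: numeral_eq_Suc)
  have "poly.coeff (line_restr h w u (pdiff j F)) 2 = meval h u (pdiff j F)" for j
    using coeff_line_restr_reverse[OF pF, of 2 w u j] by (simp add: coeff_0_line_restr)
  then have "poly.coeff R 2 = poly.coeff (line_restr h p u F) 2"
    by (simp add: R_def coeff_sum coeff_2_line_restr_cubic[OF F])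
  then have "Polynomial.degree R > 0"
    using False le_degree[of R 2] by simp
  then obtain s where "poly R s = 0"
    using alg_closed_imp_poly_has_root by blast
  then have "poly.coeff (line_restr h p (\<lambda>j. w j + s * u j) F) 2 = 0"
    by (simp add: R_def poly_sum poly_line_restr coeff_2_line_restr_cubic[OF F])
  then show ?thesis using that by blast
qed (use that in blast)

text \<open>
  The heart of the matter: a linear relation between the differentials of the contact equations
  produces a singular point on the line.  The indices \<open>i\<close> and \<open>i'\<close> are the two coordinates
  normalised by the chart; there are no derivatives by \<open>p\<^sub>i\<close>, \<open>v\<^sub>i\<close> and \<open>v\<^sub>i\<^sub>'\<close>, which is why the
  hypotheses leave these indices out.
\<close>

lemma singular_point_of_dependent_contact:
  fixes c :: "nat \<Rightarrow> 'b"
  assumes F: "F \<in> forms n 3" and i: "i \<le> n" "i' \<le> n"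
    and pv: "p i = 1" "v i = 0" "v i' = 1"
    and contact: "\<And>k. k < 3 \<Longrightarrow> poly.coeff (line_restr h p v F) k = 0"
    and nontriv: "l < 3" "c l \<noteq> 0"
    and rel: "\<And>j. j \<le> n \<Longrightarrow> j \<noteq> i \<Longrightarrow>
      (\<Sum>k<3. c k * poly.coeff (line_restr h p v (pdiff j F)) k) = 0"
    and rel': "\<And>j. j \<le> n \<Longrightarrow> j \<noteq> i \<Longrightarrow> j \<noteq> i' \<Longrightarrow>
      (\<Sum>k<3. c k * poly.coeff (pCons 0 (line_restr h p v (pdiff j F))) k) = 0"
  shows "\<exists>z. (\<exists>j\<le>n. z j \<noteq> 0) \<and> (\<forall>j\<le>n. meval h z (pdiff j F) = 0)"
proof -
  define g where "g j = poly.coeff (line_restr h p v (pdiff j F))" for j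
  have pF: "pdiff j F \<in> forms n 2" for j
    using F by (intro pdiff_forms) (simp add: numeral_eq_Suc)
  have sum3: "(\<Sum>k<3. f k) = f 0 + f 1 + f 2" for f :: "nat \<Rightarrow> 'b"
    by (simp add: numeral_3_eq_3 numeral_2_eq_2)
  \<comment> \<open>The derivative of \<open>F(p + t v)\<close> by \<open>t\<close> vanishes to order 2 because \<open>F(p + t v)\<close> does to order 3.\<close>
  have v: "(\<Sum>j\<le>n. v j * g j k) = 0" if "k < 2" for k
  proof -
    have "poly.coeff (pderiv (line_restr h p v F)) k = (\<Sum>j\<le>n. v j * g j k)"
      using F by (subst pderiv_line_restr[of "{..n}"])
        (auto simp: forms_iff coeff_sum g_def mult.commute)
    then show ?thesis
      using contact[of "Suc k"] that by (simp add: coeff_pderiv)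
  qed
  have euler: "(\<Sum>j\<le>n. poly.coeff ([:p j, v j:] * line_restr h p v (pdiff j F)) k) = 0" if "k < 3" for k
  proof -
    have "(\<Sum>j\<le>n. poly.coeff ([:p j, v j:] * line_restr h p v (pdiff j F)) k)
        = poly.coeff (of_nat 3 * line_restr h p v F) k"
      by (simp only: euler_line_restr[OF F, symmetric] coeff_sum)
    then show ?thesis
      using contact[OF that] by (simp add: of_nat_poly)
  qed
  have p: "(\<Sum>j\<le>n. p j * g j k) = 0" if "k < 3" for k
  proof (cases k)
    case 0
    then show ?thesis using euler[of 0] by (simp add: g_def)
  next
    case (Suc k')
    then have "(\<Sum>j\<le>n. p j * g j k) + (\<Sum>j\<le>n. v j * g j k') = 0"
      using euler[OF that] by (simp add: g_def sum.distrib)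
    then show ?thesis using v[of k'] that Suc by simp
  qed
  \<comment> \<open>A vector orthogonal to one with entry 1 at a place vanishes once its other entries do.\<close>
  have isolate: "f l = 0"
    if "(\<Sum>j\<le>n. x j * f j) = 0" "x l = 1" "l \<le> n" "\<And>j. j \<le> n \<Longrightarrow> j \<noteq> l \<Longrightarrow> x j * f j = 0"
    for x f :: "nat \<Rightarrow> 'b" and l
  proof -
    have "(\<Sum>j\<le>n. x j * f j) = (\<Sum>j\<le>n. if j = l then f l else 0)"
      using that by (intro sum.cong) auto
    then show ?thesis using that by simp
  qed
  \<comment> \<open>The combinations of gradient coefficients which the relation kills in the \<open>\<xi>\<close>- and \<open>\<zeta>\<close>-directions.\<close>
  define A where "A j = c 0 * g j 0 + c 1 * g j 1 + c 2 * g j 2" for j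
  define B where "B j = c 1 * g j 0 + c 2 * g j 1" for j
  have A: "A j = 0" if "j \<le> n" "j \<noteq> i" for j
    using rel[OF that] by (simp add: A_def sum3 g_def)
  have B: "B j = 0" if "j \<le> n" "j \<noteq> i" "j \<noteq> i'" for j
    using rel'[OF that] by (simp add: B_def sum3 g_def numeral_2_eq_2)
  have pA: "(\<Sum>j\<le>n. p j * A j) = 0"
  proof -
    have "(\<Sum>j\<le>n. p j * A j)
        = c 0 * (\<Sum>j\<le>n. p j * g j 0) + c 1 * (\<Sum>j\<le>n. p j * g j 1) + c 2 * (\<Sum>j\<le>n. p j * g j 2)"
      by (simp add: A_def sum_distrib_left sum.distrib[symmetric] algebra_simps)
    then show ?thesis by (simp add: p)
  qed
  have lin: "(\<Sum>j\<le>n. x j * B j) = c 1 * (\<Sum>j\<le>n. x j * g j 0) + c 2 * (\<Sum>j\<le>n. x j * g j 1)" for x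
    by (simp add: B_def sum_distrib_left sum.distrib[symmetric] algebra_simps)
  have A_all: "A j = 0" if "j \<le> n" for j
    using isolate[OF pA pv(1) i(1)] A that by (cases "j = i") auto
  \<comment> \<open>The entry \<open>i'\<close> comes first: since \<open>v i = 0\<close>, the possibly nonzero \<open>B i\<close> does not interfere.\<close>
  have "v j * B j = 0" if "j \<le> n" "j \<noteq> i'" for j
    using B[of j] that pv(2) by (cases "j = i") auto
  then have "B i' = 0"
    using isolate[of v B i'] pv(3) i(2) by (simp add: lin v)
  then have B': "B j = 0" if "j \<le> n" "j \<noteq> i" for j
    using B that by (cases "j = i'") auto
  have "(\<Sum>j\<le>n. p j * B j) = 0"
    by (simp add: lin p)
  then have B_all: "B j = 0" if "j \<le> n" for j
    using isolate[of p B i] pv(1) i(1) B' that by (cases "j = i") auto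
  show ?thesis
  proof (cases "c 2 = 0")
    case True
    have "g j 0 = 0" if "j \<le> n" for j
    proof (cases "c 1 = 0")
      case False
      then show ?thesis using B_all[OF that] True by (simp add: B_def)
    next
      case c1: True
      then have "l = 0"
        using nontriv True by (auto simp: less_Suc_eq numeral_3_eq_3 numeral_2_eq_2)
      then have "c 0 \<noteq> 0"
        using nontriv by simp
      then show ?thesis using A_all[OF that] True c1 by (simp add: A_def)
    qed
    then have "meval h p (pdiff j F) = 0" if "j \<le> n" for j
      using that by (simp add: g_def coeff_0_line_restr)
    moreover have "\<exists>j\<le>n. p j \<noteq> 0" using i pv by auto
    ultimately show ?thesis by blast
  next
    case False
    define a b where "a = c 0 / c 2" and "b = c 1 / c 2"
    have g1: "g j 1 = - b * g j 0" if "j \<le> n" for j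
    proof -
      have "c 2 * g j 1 = - (c 1 * g j 0)"
        using B_all[OF that] by (simp add: B_def eq_neg_iff_add_eq_0 add.commute)
      then show ?thesis
        using False by (simp add: b_def field_simps)
    qed
    have g2: "g j 2 = (b\<^sup>2 - a) * g j 0" if "j \<le> n" for j
    proof -
      have "g j 2 = - a * g j 0 - b * g j 1"
      proof -
        have "c 2 * g j 2 = - (c 0 * g j 0) - c 1 * g j 1"
          using A_all[OF that] by (simp add: A_def eq_diff_eq eq_neg_iff_add_eq_0 algebra_simps)
        then show ?thesis
          using False by (simp add: a_def b_def field_simps)
      qed
      then show ?thesis
        unfolding g1[OF that] by (simp add: power2_eq_square algebra_simps)
    qed
    \<comment> \<open>With \<open>v + s p\<close> instead of \<open>p + t v\<close> the polynomial is monic, so that it always has a root.\<close>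
    obtain s where s: "poly [:b\<^sup>2 - a, - b, 1:] s = 0"
      using alg_closed_imp_poly_has_root[of "[:b\<^sup>2 - a, - b, 1:]"] by auto
    have "meval h (\<lambda>j. v j + s * p j) (pdiff j F) = 0" if "j \<le> n" for j
    proof -
      let ?q = "line_restr h v p (pdiff j F)"
      have rev: "poly.coeff ?q k = g j (2 - k)" if "k \<le> 2" for k
        unfolding g_def by (rule coeff_line_restr_reverse[OF pF that])
      have "poly.coeff ?q k = poly.coeff [:g j 2, g j 1, g j 0:] k" for k
      proof (cases "k \<le> 2")
        case True
        then have "k = 0 \<or> k = 1 \<or> k = 2" by linarith
        then show ?thesis
          using rev[of 0] rev[of 1] rev[of 2] by (auto simp: numeral_2_eq_2)
      next
        case False
        then have "poly.coeff ?q k = 0"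
          using degree_line_restr[OF pF, of v p j] by (intro coeff_eq_0) linarith
        moreover have "poly.coeff [:g j 2, g j 1, g j 0:] k = 0"
          using False by (intro coeff_eq_0) auto
        ultimately show ?thesis by simp
      qed
      then have "?q = [:g j 2, g j 1, g j 0:]"
        by (rule poly_eqI)
      then have "poly ?q s = g j 0 * poly [:b\<^sup>2 - a, - b, 1:] s"
        by (simp add: g1[OF that, unfolded One_nat_def] g2[OF that] ring_distribs mult_ac)
      then show ?thesis
        using s by (simp add: poly_line_restr)
    qed
    moreover have "\<exists>j\<le>n. v j + s * p j \<noteq> 0"
    proof (cases "s = 0")
      case True
      then show ?thesis using i pv by (intro exI[of _ i']) auto
    next
      case False
      then show ?thesis using i pv by (intro exI[of _ i]) auto
    qed
    ultimately show ?thesis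
      by (intro exI[of _ "\<lambda>j. v j + s * p j"] conjI) simp_all
  qed
qed

end

section \<open>The Jacobian criterion\<close>

text \<open>
  A homogeneous linear system with more unknowns than equations has a nontrivial solution;
  elimination of one unknown reduces it by one equation.
\<close>

lemma nontrivial_linear_relation:
  fixes M :: "'i \<Rightarrow> 'e \<Rightarrow> 'b::field"
  assumes "finite E" "finite I" "card E < card I"
  shows "\<exists>d. (\<exists>i\<in>I. d i \<noteq> 0) \<and> (\<forall>e\<in>E. (\<Sum>i\<in>I. d i * M i e) = 0)"
  using assms
proof (induction E arbitrary: I M rule: finite_induct)
  case empty
  then have "I \<noteq> {}" by auto
  then show ?case by (intro exI[of _ "\<lambda>_. 1"]) auto
next
  case (insert e E)
  show ?case
  proof (cases "\<forall>i\<in>I. M i e = 0")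
    case True
    then show ?thesis
      using insert.IH[OF insert.prems(1), of M] insert.prems insert.hyps by auto
  next
    case False
    then obtain k where k: "k \<in> I" "M k e \<noteq> 0" by blast
    define J where "J = I - {k}"
    have J: "finite J" "k \<notin> J" and I: "I = insert k J"
      using k insert.prems by (auto simp: J_def)
    have "card E < card J"
      using insert.prems insert.hyps J by (simp add: I)
    then obtain d where d: "\<exists>i\<in>J. d i \<noteq> 0"
      and rel: "\<And>e'. e' \<in> E \<Longrightarrow> (\<Sum>i\<in>J. d i * (M i e' - M i e / M k e * M k e')) = 0"
      using insert.IH[OF J(1), of "\<lambda>i e'. M i e' - M i e / M k e * M k e'"] by blast
    define t where "t = (\<Sum>i\<in>J. d i * M i e) / M k e"
    have sum: "(\<Sum>i\<in>I. (d(k := - t)) i * M i e') = (\<Sum>i\<in>J. d i * M i e') - t * M k e'" for e'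
    proof -
      have "(\<Sum>i\<in>J. (d(k := - t)) i * M i e') = (\<Sum>i\<in>J. d i * M i e')"
        using J by (intro sum.cong) auto
      then show ?thesis using J by (simp add: I)
    qed
    have "(\<Sum>i\<in>I. (d(k := - t)) i * M i e') = 0" if "e' \<in> insert e E" for e'
    proof (cases "e' = e")
      case True
      then show ?thesis using k unfolding sum by (simp add: t_def)
    next
      case False
      then have "e' \<in> E" using that by simp
      have "(\<Sum>i\<in>J. d i * (M i e' - M i e / M k e * M k e'))
          = (\<Sum>i\<in>J. d i * M i e') - t * M k e'"
        by (simp add: t_def right_diff_distrib sum_subtractf sum_divide_distrib sum_distrib_right mult.assoc)
      then show ?thesis using rel[OF \<open>e' \<in> E\<close>] unfolding sum by simp
    qed
    moreover have "\<exists>i\<in>I. (d(k := - t)) i \<noteq> 0"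
      using d J by (auto simp: I)
    ultimately show ?thesis by blast
  qed
qed

text \<open>
  The equations themselves serve as the local generators, with denominator \<open>1\<close>.
\<close>

lemma smooth_at_if_independent:
  assumes "length G + r = card S"
    and "\<And>c. (\<And>s. s \<in> S \<Longrightarrow> (\<Sum>i<length G. c i * eval_at y (pdiff s (G ! i))) = 0)
           \<Longrightarrow> (\<forall>i<length G. c i = 0)"
  shows "smooth_at S (gen_ideal S (set G)) r y"
proof -
  interpret e: coeff_hom "eval_at y"
    by (rule coeff_hom.coeff_hom_meval[OF coeff_hom_id])
  have const_in: "0 \<in> polys_in S" "1 \<in> polys_in S"
    by (auto simp: polys_in_def)
  have "g \<in> gen_ideal S (set G)" if "g \<in> set G" for g
  proof -
    have "(\<Sum>g'\<in>set G. (if g' = g then 1 else 0) * g') = (\<Sum>g'\<in>set G. if g' = g then g else 0)"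
      by (intro sum.cong) auto
    then have "(\<Sum>g'\<in>set G. (if g' = g then 1 else 0) * g') = g"
      using that by simp
    then show ?thesis
      unfolding gen_ideal_def using const_in
      by (intro CollectI exI[of _ "\<lambda>g'. if g' = g then 1 else 0"]) auto
  qed
  moreover have "\<exists>h\<in>polys_in S. eval_at y h \<noteq> 0 \<and> h * f \<in> gen_ideal S (set G)"
    if "f \<in> gen_ideal S (set G)" for f
    using that const_in by (intro bexI[of _ 1]) auto
  ultimately show ?thesis
    unfolding smooth_at_def using assms by (intro exI[of _ G]) blast
qed

text \<open>
  At a zero \<open>y\<close> of \<open>E\<close> the differential of an ideal element is a combination of the differentials of
  the equations, because the coefficients are differentiated only in terms that vanish at \<open>y\<close>.  If
  one of these differentials is zero, the remaining ones are fewer than the generators in the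
  definition of smoothness, whose differentials are therefore dependent.
\<close>

lemma not_smooth_at_if_differential_zero:
  assumes "finite E" and zero: "\<And>f. f \<in> E \<Longrightarrow> eval_at y f = 0"
    and f: "f \<in> E" "\<And>s. s \<in> S \<Longrightarrow> eval_at y (pdiff s f) = 0"
    and codim: "card E + r \<le> card S"
  shows "\<not> smooth_at S (gen_ideal S E) r y"
proof
  assume "smooth_at S (gen_ideal S E) r y"
  then obtain G where G: "set G \<subseteq> gen_ideal S E" "length G + r = card S"
    and indep: "\<And>c. (\<forall>s\<in>S. (\<Sum>i<length G. c i * eval_at y (pdiff s (G ! i))) = 0)
                \<Longrightarrow> (\<forall>i<length G. c i = 0)"
    unfolding smooth_at_def by blast
  have "\<forall>i. \<exists>c. i < length G \<longrightarrow> G ! i = (\<Sum>g\<in>E. c g * g)"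
  proof
    fix i
    show "\<exists>c. i < length G \<longrightarrow> G ! i = (\<Sum>g\<in>E. c g * g)"
    proof (cases "i < length G")
      case True
      then have "G ! i \<in> gen_ideal S E"
        using G(1) by auto
      then show ?thesis
        unfolding gen_ideal_def by blast
    qed simp
  qed
  from choice[OF this] obtain c where c: "\<forall>i. i < length G \<longrightarrow> G ! i = (\<Sum>g\<in>E. c i g * g)"
    by blast
  interpret e: coeff_hom "eval_at y"
    by (rule coeff_hom.coeff_hom_meval[OF coeff_hom_id])
  have diff: "eval_at y (pdiff s (G ! i)) =
      (\<Sum>g\<in>E - {f}. eval_at y (c i g) * eval_at y (pdiff s g))" if "i < length G" "s \<in> S" for i s
  proof -
    have "eval_at y (pdiff s (G ! i)) = (\<Sum>g\<in>E. eval_at y (c i g) * eval_at y (pdiff s g))"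
      unfolding c[rule_format, OF that(1)] pdiff_sum pdiff_mult e.hom_sum e.hom_add e.hom_mult
      by (intro sum.cong) (simp_all only: zero mult_zero_left add_0_right)
    also have "\<dots> = (\<Sum>g\<in>E - {f}. eval_at y (c i g) * eval_at y (pdiff s g))"
      using f that(2) \<open>finite E\<close> by (intro sum.mono_neutral_right) auto
    finally show ?thesis .
  qed
  have "card (E - {f}) < card {..<length G}"
    using codim G(2) f(1) \<open>finite E\<close> card_Diff1_less[of E f] by simp
  then obtain d where d: "\<exists>i<length G. d i \<noteq> 0"
    and rel: "\<And>g. g \<in> E - {f} \<Longrightarrow> (\<Sum>i<length G. d i * eval_at y (c i g)) = 0"
    using nontrivial_linear_relation[of "E - {f}" "{..<length G}" "\<lambda>i g. eval_at y (c i g)"]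
      \<open>finite E\<close> by auto
  have "(\<Sum>i<length G. d i * eval_at y (pdiff s (G ! i))) = 0" if "s \<in> S" for s
  proof -
    have "(\<Sum>i<length G. d i * eval_at y (pdiff s (G ! i)))
        = (\<Sum>i<length G. \<Sum>g\<in>E - {f}. d i * eval_at y (c i g) * eval_at y (pdiff s g))"
      using that by (intro sum.cong) (auto simp: diff sum_distrib_left mult.assoc)
    also have "\<dots> = (\<Sum>g\<in>E - {f}. (\<Sum>i<length G. d i * eval_at y (c i g)) * eval_at y (pdiff s g))"
      by (subst sum.swap) (simp add: sum_distrib_right)
    also have "\<dots> = 0"
      using rel by simp
    finally show ?thesis .
  qed
  then show False
    using indep d by blast
qed

section \<open>The hypersurface\<close>

text \<open>
  Homogeneous coordinates of a singular point; that \<open>F\<close> itself vanishes there is left to Euler's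
  identity.
\<close>

definition singular_vector :: "nat \<Rightarrow> (nat, 'a::field) mpoly \<Rightarrow> (nat \<Rightarrow> 'a alg_closure) \<Rightarrow> bool" where
  "singular_vector n F z \<longleftrightarrow> (\<exists>j\<le>n. z j \<noteq> 0) \<and> (\<forall>j\<le>n. meval to_ac z (pdiff j F) = 0)"

interpretation ac: coeff_hom to_ac
  by (rule coeff_hom_to_ac)

interpretation ac: coeff_hom_alg_closed "to_ac :: 'a::field \<Rightarrow> 'a alg_closure"
  by unfold_locales

lemma singular_vector_zero:
  fixes F :: "(nat, 'a::field) mpoly"
  assumes "singular_vector n F z" "F \<in> forms n d" "of_nat d \<noteq> (0 :: 'a)"
  shows "meval to_ac z F = 0"
proof -
  have "of_nat d * meval to_ac z F = 0"
    using assms(1) by (simp add: ac.euler_identity[OF assms(2), symmetric] singular_vector_def)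
  moreover have "of_nat d \<noteq> (0 :: 'a alg_closure)"
    using assms(3) by (metis to_ac_eq_0_iff to_ac_of_nat)
  ultimately show ?thesis by simp
qed

lemma singular_vector_normalize:
  fixes F :: "(nat, 'a::field) mpoly"
  assumes "singular_vector n F z" "F \<in> forms n (Suc d)"
  obtains i w where "i \<le> n" "w i = 1" "singular_vector n F w"
proof -
  obtain i where i: "i \<le> n" "z i \<noteq> 0"
    using assms(1) by (auto simp: singular_vector_def)
  define w where "w = (\<lambda>j. inverse (z i) * z j)"
  have "meval to_ac w (pdiff j F) = 0" if "j \<le> n" for j
    unfolding w_def meval_scale[OF pdiff_forms[OF assms(2)]]
    using assms(1) that by (simp add: singular_vector_def)
  moreover have "w i = 1" using i by (simp add: w_def)
  ultimately show ?thesis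
    using i by (intro that[of i w]) (auto simp: singular_vector_def intro!: exI[of _ i])
qed

lemma meval_dehomogenize:
  "meval to_ac y (meval mconst (\<lambda>j. if j = i then 1 else mvar j) F) = meval to_ac (y(i := 1)) F"
proof -
  interpret y: coeff_hom "meval to_ac y"
    by (rule ac.coeff_hom_meval)
  have "(\<lambda>v. meval to_ac y (if v = i then 1 else mvar v)) = y(i := 1)"
    by auto
  then show ?thesis
    by (simp add: y.hom_meval[OF coeff_hom_mconst])
qed

lemma meval_pdiff_dehomogenize:
  fixes F :: "(nat, 'a::field) mpoly"
  assumes "F \<in> polys_in {..n}" "s \<in> {..n} - {i}"
  shows "meval to_ac y (pdiff s (meval mconst (\<lambda>j. if j = i then 1 else mvar j) F)) =
    meval to_ac (y(i := 1)) (pdiff s F)"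
proof -
  interpret y: derivation "meval to_ac y" "\<lambda>p. meval to_ac y (pdiff s p)"
    by (rule ac.derivation_meval)
  have "(\<lambda>v. meval to_ac y (if v = i then 1 else mvar v)) = y(i := 1)"
    by auto
  moreover have "meval to_ac y (pdiff s (if j = i then 1 else mvar j)) = (if j = s then 1 else 0)" for j
    using assms(2) by (auto simp: pdiff_mvar)
  ultimately show ?thesis
    using assms(2) by (subst y.chain_rule[OF coeff_hom_mconst _ _ assms(1)])
      (simp_all add: if_distrib[of "(*) _"] cong: if_cong)
qed

text \<open>
  Dehomogenising at \<open>x\<^sub>i\<close> loses the derivative by \<open>x\<^sub>i\<close>; Euler's identity recovers its vanishing from
  that of \<open>F\<close> and of the other derivatives.
\<close>

lemma smooth_hypersurface_iff:
  fixes F :: "(nat, 'a::field) mpoly"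
  assumes F: "F \<in> forms n (Suc d)" and char: "of_nat (Suc d) \<noteq> (0 :: 'a)" and "n \<ge> 1"
  shows "smooth_of_dim (n - 1) (X_charts n F) \<longleftrightarrow> \<not> (\<exists>z. singular_vector n F z)"
proof -
  define f where "f i = meval mconst (\<lambda>j. if j = i then 1 else mvar j) F" for i
  define f' where "f' i = Poly_Mapping.map to_ac (f i)" for i
  have val: "eval_at y (f' i) = meval to_ac (y(i := 1)) F" for i y
    by (simp add: f'_def f_def ac.eval_at_map meval_dehomogenize)
  have der: "eval_at y (pdiff s (f' i)) = meval to_ac (y(i := 1)) (pdiff s F)"
    if "s \<in> {..n} - {i}" for i y s
    using F by (simp add: f'_def f_def ac.pdiff_map ac.eval_at_map forms_iff
        meval_pdiff_dehomogenize[OF _ that])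
  have smooth_iff: "smooth_of_dim (n - 1) (X_charts n F) \<longleftrightarrow>
      (\<forall>i\<le>n. \<forall>y. eval_at y (f' i) = 0 \<longrightarrow> smooth_at ({..n} - {i}) (gen_ideal ({..n} - {i}) {f' i}) (n - 1) y)"
    by (simp add: smooth_of_dim_def X_charts_def Let_def setcompr_eq_image f'_def f_def)
  have card: "card ({..n} - {i}) = n" if "i \<le> n" for i
    using that by simp
  show ?thesis
  proof
    assume smooth: "smooth_of_dim (n - 1) (X_charts n F)"
    show "\<not> (\<exists>z. singular_vector n F z)"
    proof
      assume "\<exists>z. singular_vector n F z"
      then obtain i w where w: "i \<le> n" "w i = 1" "singular_vector n F w"
        using singular_vector_normalize F by blast
      have upd: "w(i := 1) = w" using w(2) by auto
      have "eval_at w (f' i) = 0"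
        using singular_vector_zero[OF w(3) F char] by (simp add: val upd)
      moreover have "\<not> smooth_at ({..n} - {i}) (gen_ideal ({..n} - {i}) {f' i}) (n - 1) w"
        using w calculation \<open>n \<ge> 1\<close> card[of i]
        by (intro not_smooth_at_if_differential_zero[of _ _ "f' i"])
          (auto simp: der upd singular_vector_def)
      ultimately show False
        using smooth smooth_iff w(1) by blast
    qed
  next
    assume nonsing: "\<not> (\<exists>z. singular_vector n F z)"
    show "smooth_of_dim (n - 1) (X_charts n F)"
      unfolding smooth_iff
    proof (intro allI impI)
      fix i y assume i: "i \<le> n" and zero: "eval_at y (f' i) = 0"
      let ?z = "y(i := 1)"
      have "\<exists>s\<in>{..n} - {i}. eval_at y (pdiff s (f' i)) \<noteq> 0"
      proof (rule ccontr)
        assume "\<not> ?thesis"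
        then have partial: "meval to_ac ?z (pdiff s F) = 0" if "s \<in> {..n} - {i}" for s
          using that der[OF that, of y] by auto
        have "(\<Sum>j\<le>n. ?z j * meval to_ac ?z (pdiff j F)) = 0"
          using zero unfolding ac.euler_identity[OF F] val by (simp only: mult_zero_right)
        moreover have "(\<Sum>j\<le>n. ?z j * meval to_ac ?z (pdiff j F))
            = (\<Sum>j\<le>n. if j = i then meval to_ac ?z (pdiff i F) else 0)"
          using partial by (intro sum.cong) auto
        ultimately have "meval to_ac ?z (pdiff i F) = 0"
          using i by simp
        then have "singular_vector n F ?z"
          unfolding singular_vector_def using partial i by (metis Diff_iff atMost_iff fun_upd_same
              singletonD zero_neq_one)
        then show False using nonsing by blast
      qed
      then have "smooth_at ({..n} - {i}) (gen_ideal ({..n} - {i}) (set [f' i])) (n - 1) y"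
        using card[OF i] \<open>n \<ge> 1\<close> by (intro smooth_at_if_independent) auto
      then show "smooth_at ({..n} - {i}) (gen_ideal ({..n} - {i}) {f' i}) (n - 1) y"
        by simp
    qed
  qed
qed

section \<open>The scheme of lines with contact\<close>

definition flag_point :: "(nat \<Rightarrow> nat) \<Rightarrow> (coord \<Rightarrow> 'b) \<Rightarrow> nat \<Rightarrow> 'b::field" where
  "flag_point \<sigma> y j = (if \<sigma> j = 0 then 1 else y (Xi (\<sigma> j)))"

definition flag_dir :: "(nat \<Rightarrow> nat) \<Rightarrow> (coord \<Rightarrow> 'b) \<Rightarrow> nat \<Rightarrow> 'b::field" where
  "flag_dir \<sigma> y j = (if \<sigma> j = 0 then 0 else if \<sigma> j = 1 then 1 else y (Zeta (\<sigma> j)))"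

lemma map_poly_line_param:
  "map_poly (meval to_ac y) (line_param (\<sigma> j)) = [:flag_point \<sigma> y j, flag_dir \<sigma> y j:]"
  by (auto simp: line_param_def flag_point_def flag_dir_def map_poly_pCons one_pCons)

lemma meval_contact_coeff:
  "meval to_ac y (contact_coeff \<sigma> F k) =
     poly.coeff (line_restr to_ac (flag_point \<sigma> y) (flag_dir \<sigma> y) F) k"
proof -
  interpret y: coeff_hom "meval to_ac y"
    by (rule ac.coeff_hom_meval)
  interpret Y: coeff_hom "map_poly (meval to_ac y)"
    by (rule y.coeff_hom_map_poly)
  have "meval to_ac y (contact_coeff \<sigma> F k)
      = poly.coeff (map_poly (meval to_ac y) (meval (\<lambda>c. [:mconst c:]) (\<lambda>j. line_param (\<sigma> j)) F)) k"
    by (simp add: contact_coeff_def coeff_map_poly)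
  then show ?thesis
    by (simp add: Y.hom_meval[OF coeff_hom.coeff_hom_pCons[OF coeff_hom_mconst]] map_poly_pCons
        map_poly_line_param line_restr_def)
qed

text \<open>
  The chain rule for the substitution of \<^const>\<open>line_param\<close> into \<open>F\<close>, with coefficientwise
  differentiation by the chart coordinate \<open>s\<close>.
\<close>

lemma meval_pdiff_contact_coeff:
  fixes F :: "(nat, 'a::field) mpoly"
  assumes "F \<in> polys_in S" "finite S"
  shows "meval to_ac y (pdiff s (contact_coeff \<sigma> F k)) = poly.coeff (\<Sum>j\<in>S.
     line_restr to_ac (flag_point \<sigma> y) (flag_dir \<sigma> y) (pdiff j F)
       * map_poly (\<lambda>p. meval to_ac y (pdiff s p)) (line_param (\<sigma> j))) k"
proof -
  interpret y: derivation "meval to_ac y" "\<lambda>p. meval to_ac y (pdiff s p)"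
    by (rule ac.derivation_meval)
  interpret Y: derivation "map_poly (meval to_ac y)" "map_poly (\<lambda>p. meval to_ac y (pdiff s p))"
    by (rule y.derivation_map_poly)
  have "meval to_ac y (pdiff s (contact_coeff \<sigma> F k)) = poly.coeff
     (map_poly (\<lambda>p. meval to_ac y (pdiff s p)) (meval (\<lambda>c. [:mconst c:]) (\<lambda>j. line_param (\<sigma> j)) F)) k"
    by (simp add: contact_coeff_def coeff_map_poly)
  then show ?thesis
    by (subst (asm) Y.chain_rule[OF coeff_hom.coeff_hom_pCons[OF coeff_hom_mconst] _ assms(2,1)])
      (simp_all add: map_poly_pCons map_poly_line_param line_restr_def)
qed

text \<open>
  The coordinates \<open>\<xi>\<close> and \<open>\<zeta>\<close> numbered \<open>\<sigma> j\<close> occur only in the \<open>j\<close>-th entry of the parametrised line,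
  with derivatives \<open>1\<close> and \<open>t\<close>.
\<close>

lemma
  fixes F :: "(nat, 'a::field) mpoly"
  assumes F: "F \<in> polys_in {..n}" and \<sigma>: "inj \<sigma>" and j: "j \<le> n" "\<sigma> j \<noteq> 0"
  shows meval_pdiff_Xi_contact_coeff:
      "meval to_ac y (pdiff (Xi (\<sigma> j)) (contact_coeff \<sigma> F k)) =
       poly.coeff (line_restr to_ac (flag_point \<sigma> y) (flag_dir \<sigma> y) (pdiff j F)) k"
    and meval_pdiff_Zeta_contact_coeff:
      "\<sigma> j \<noteq> 1 \<Longrightarrow> meval to_ac y (pdiff (Zeta (\<sigma> j)) (contact_coeff \<sigma> F k)) =
       poly.coeff (pCons 0 (line_restr to_ac (flag_point \<sigma> y) (flag_dir \<sigma> y) (pdiff j F))) k"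
proof -
  let ?L = "\<lambda>j'. line_restr to_ac (flag_point \<sigma> y) (flag_dir \<sigma> y) (pdiff j' F)"
  have eq: "\<sigma> j' = \<sigma> j \<longleftrightarrow> j' = j" for j'
    using \<sigma> by (auto dest: injD)
  have "map_poly (\<lambda>p. meval to_ac y (pdiff (Xi (\<sigma> j)) p)) (line_param (\<sigma> j') :: (coord, 'a) mpoly poly)
      = (if j' = j then 1 else 0)" for j'
    using j eq[of j'] by (auto simp: line_param_def pdiff_mvar map_poly_pCons one_pCons)
  then have "(\<Sum>j'\<le>n. ?L j' * map_poly (\<lambda>p. meval to_ac y (pdiff (Xi (\<sigma> j)) p)) (line_param (\<sigma> j')))
      = ?L j"
    using j by (simp add: if_distrib[of "(*) _"] cong: if_cong)
  then show "meval to_ac y (pdiff (Xi (\<sigma> j)) (contact_coeff \<sigma> F k)) = poly.coeff (?L j) k"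
    by (simp add: meval_pdiff_contact_coeff[OF F])
  assume j1: "\<sigma> j \<noteq> 1"
  have "map_poly (\<lambda>p. meval to_ac y (pdiff (Zeta (\<sigma> j)) p)) (line_param (\<sigma> j') :: (coord, 'a) mpoly poly)
      = (if j' = j then [:0, 1:] else 0)" for j'
    using j j1 eq[of j'] by (auto simp: line_param_def pdiff_mvar map_poly_pCons one_pCons)
  then have "(\<Sum>j'\<le>n. ?L j' * map_poly (\<lambda>p. meval to_ac y (pdiff (Zeta (\<sigma> j)) p)) (line_param (\<sigma> j')))
      = pCons 0 (?L j)"
    using j by (simp add: if_distrib[of "(*) _"] cong: if_cong)
  then show "meval to_ac y (pdiff (Zeta (\<sigma> j)) (contact_coeff \<sigma> F k)) = poly.coeff (pCons 0 (?L j)) k"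
    by (simp add: meval_pdiff_contact_coeff[OF F])
qed

lemma card_flag_coords:
  assumes "n \<ge> 1"
  shows "card (flag_coords n) = 2 * n - 1"
proof -
  have "card (Xi ` {1..n} \<union> Zeta ` {2..n}) = card (Xi ` {1..n}) + card (Zeta ` {2..n})"
    by (intro card_Un_disjoint) auto
  then show ?thesis
    using assms by (simp add: flag_coords_def card_image inj_on_def)
qed

text \<open>
  Every point and direction normalised at \<open>i\<close> and \<open>i'\<close> lies in the chart of a permutation that moves
  these indices to \<open>0\<close> and \<open>1\<close>.
\<close>

lemma obtain_chart:
  fixes p v :: "nat \<Rightarrow> 'b::field"
  assumes "i \<le> n" "i' \<le> n" "i \<noteq> i'" "n \<ge> 1" and pv: "p i = 1" "v i = 0" "v i' = 1"
  obtains \<sigma> y where "\<sigma> permutes {..n}" "flag_point \<sigma> y = p" "flag_dir \<sigma> y = v"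
proof -
  define \<tau> where "\<tau> = Transposition.transpose i 0"
  define \<sigma> where "\<sigma> = Transposition.transpose (\<tau> i') 1 \<circ> \<tau>"
  have \<tau>: "\<tau> permutes {..n}"
    unfolding \<tau>_def using assms by (intro permutes_swap_id) auto
  have \<tau>': "\<tau> i = 0" "\<tau> i' \<noteq> 0"
    using assms by (auto simp: \<tau>_def transpose_def)
  have "\<tau> i' \<le> n"
    using permutes_in_image[OF \<tau>, of i'] assms by simp
  then have \<sigma>: "\<sigma> permutes {..n}"
    unfolding \<sigma>_def using assms by (intro permutes_compose[OF \<tau>] permutes_swap_id) auto
  have "\<sigma> i = 0" "\<sigma> i' = 1"
    using \<tau>' by (auto simp: \<sigma>_def transpose_def)
  moreover have "inj \<sigma>"
    using \<sigma> by (rule permutes_inj)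
  ultimately have "\<sigma> j = 0 \<longleftrightarrow> j = i" "\<sigma> j = 1 \<longleftrightarrow> j = i'" "inv_into UNIV \<sigma> (\<sigma> j) = j" for j
    by (metis injD, metis injD, simp add: inv_f_f)
  then show ?thesis
    using pv by (intro that[of \<sigma> "case_coord (\<lambda>l. p (inv_into UNIV \<sigma> l)) (\<lambda>l. v (inv_into UNIV \<sigma> l))"] \<sigma>)
      (auto simp: flag_point_def flag_dir_def fun_eq_iff)
qed

text \<open>
  A singular point together with an asymptotic direction is a point at which the first contact
  equation has zero differential; a point with dependent differentials yields a singular point.
\<close>

lemma smooth_contact_scheme_iff:
  fixes F :: "(nat, 'a::field) mpoly"
  assumes F: "F \<in> forms n 3" and char: "of_nat 3 \<noteq> (0 :: 'a)" and n: "n \<ge> 2"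
  shows "smooth_of_dim (2 * n - 4) (Y_charts n F 3) \<longleftrightarrow> \<not> (\<exists>z. singular_vector n F z)"
proof -
  define e where "e \<sigma> k = Poly_Mapping.map to_ac (contact_coeff \<sigma> F k)" for \<sigma> k
  have poly: "F \<in> polys_in {..n}" using F by (simp add: forms_iff)
  have val: "eval_at y (e \<sigma> k) = poly.coeff (line_restr to_ac (flag_point \<sigma> y) (flag_dir \<sigma> y) F) k"
    for y \<sigma> k
    by (simp add: e_def ac.eval_at_map meval_contact_coeff)
  have der: "eval_at y (pdiff s (e \<sigma> k)) = meval to_ac y (pdiff s (contact_coeff \<sigma> F k))" for y s \<sigma> k
    by (simp add: e_def ac.pdiff_map ac.eval_at_map)
  have smooth_iff: "smooth_of_dim (2 * n - 4) (Y_charts n F 3) \<longleftrightarrow>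
      (\<forall>\<sigma>. \<sigma> permutes {..n} \<longrightarrow> (\<forall>y. (\<forall>k<3. eval_at y (e \<sigma> k) = 0) \<longrightarrow>
         smooth_at (flag_coords n) (gen_ideal (flag_coords n) (e \<sigma> ` {..<3})) (2 * n - 4) y))"
    by (simp add: smooth_of_dim_def Y_charts_def Let_def setcompr_eq_image image_image lessThan_def e_def)
  have card: "card (flag_coords n) = 3 + (2 * n - 4)"
    using n by (simp add: card_flag_coords)
  show ?thesis
  proof
    assume smooth: "smooth_of_dim (2 * n - 4) (Y_charts n F 3)"
    show "\<not> (\<exists>z. singular_vector n F z)"
    proof
      assume "\<exists>z. singular_vector n F z"
      then obtain i p where i: "i \<le> n" "p i = 1" and p: "singular_vector n F p"
        using singular_vector_normalize[of n F _ 2] F by (metis numeral_3_eq_3 numeral_2_eq_2)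
      have grad: "meval to_ac p (pdiff j F) = 0" if "j \<le> n" for j
        using p that by (simp add: singular_vector_def)
      obtain a b where ab: "a \<le> n" "b \<le> n" "a \<noteq> i" "b \<noteq> i" "a \<noteq> b"
      proof -
        have "\<exists>a b. a \<le> n \<and> b \<le> n \<and> a \<noteq> i \<and> b \<noteq> i \<and> a \<noteq> b"
        proof (cases "i = 0")
          case True
          then show ?thesis using n by (intro exI[of _ 1] exI[of _ 2]) auto
        next
          case False
          then show ?thesis using n by (intro exI[of _ 0] exI[of _ "if i = 1 then 2 else 1"]) auto
        qed
        then show ?thesis using that by blast
      qed
      define u :: "nat \<Rightarrow> 'a alg_closure" where "u j = (if j = a then 1 else 0)" for j
      define w :: "nat \<Rightarrow> 'a alg_closure" where "w j = (if j = b then 1 else 0)" for j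
      \<comment> \<open>An asymptotic direction in the span of two coordinate vectors, normalised at one of them.\<close>
      obtain i' v where v: "i' \<le> n" "i' \<noteq> i" "v i = 0" "v i' = 1"
        and two: "poly.coeff (line_restr to_ac p v F) 2 = 0"
      proof (rule ac.asymptotic_direction[OF F, where p = p and u = u and w = w])
        assume "poly.coeff (line_restr to_ac p u F) 2 = 0"
        then show thesis
          using ab by (intro that[of a u]) (auto simp: u_def)
      next
        fix s assume "poly.coeff (line_restr to_ac p (\<lambda>j. w j + s * u j) F) 2 = 0"
        then show thesis
          using ab by (intro that[of b "\<lambda>j. w j + s * u j"]) (auto simp: u_def w_def)
      qed
      obtain \<sigma> y where \<sigma>: "\<sigma> permutes {..n}" and y: "flag_point \<sigma> y = p" "flag_dir \<sigma> y = v"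
        using obtain_chart[of i n i' p v] i v n by (metis One_nat_def Suc_leD numeral_2_eq_2)
      have zero: "poly.coeff (line_restr to_ac p v F) 0 = 0"
        using singular_vector_zero[OF p F char] by (simp add: ac.coeff_0_line_restr)
      have "poly.coeff (line_restr to_ac p v F) 1 = poly.coeff (pderiv (line_restr to_ac p v F)) 0"
        by (simp add: coeff_pderiv)
      also have "\<dots> = 0"
        using grad by (simp add: ac.pderiv_line_restr[OF _ poly] coeff_sum coeff_mult_0 ac.coeff_0_line_restr)
      finally have one: "poly.coeff (line_restr to_ac p v F) 1 = 0" .
      have contact: "eval_at y (e \<sigma> k) = 0" if "k < 3" for k
      proof -
        have "k = 0 \<or> k = 1 \<or> k = 2" using that by auto
        then show ?thesis using zero one two by (auto simp: val y)
      qed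
      have inj: "inj \<sigma>" using \<sigma> by (rule permutes_inj)
      have diff0: "eval_at y (pdiff s (e \<sigma> 0)) = 0" if mem: "s \<in> flag_coords n" for s
      proof -
        obtain l where l: "1 \<le> l" "l \<le> n" "s = Xi l \<or> s = Zeta l \<and> l \<noteq> 1"
          using mem by (auto simp: flag_coords_def)
        obtain j where j: "\<sigma> j = l" "j \<le> n"
          using l(2) permutes_image[OF \<sigma>] by (metis atMost_iff imageE)
        then show ?thesis
          using l grad meval_pdiff_Xi_contact_coeff[OF poly inj, of j y 0]
            meval_pdiff_Zeta_contact_coeff[OF poly inj, of j y 0]
          by (auto simp: der y ac.coeff_0_line_restr)
      qed
      have "card (e \<sigma> ` {..<3}) \<le> 3"
        using card_image_le[of "{..<3::nat}" "e \<sigma>"] by simp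
      then have "\<not> smooth_at (flag_coords n) (gen_ideal (flag_coords n) (e \<sigma> ` {..<3})) (2 * n - 4) y"
        using contact diff0 card by (intro not_smooth_at_if_differential_zero[of _ _ "e \<sigma> 0"]) auto
      then show False
        using smooth smooth_iff \<sigma> contact by blast
    qed
  next
    assume nonsing: "\<not> (\<exists>z. singular_vector n F z)"
    show "smooth_of_dim (2 * n - 4) (Y_charts n F 3)"
      unfolding smooth_iff
    proof (intro allI impI)
      fix \<sigma> y assume \<sigma>: "\<sigma> permutes {..n}" and zero: "\<forall>k<3. eval_at y (e \<sigma> k) = 0"
      let ?G = "map (e \<sigma>) [0..<3]"
      have inj: "inj \<sigma>" using \<sigma> by (rule permutes_inj)
      obtain i i' where i: "\<sigma> i = 0" "i \<le> n" "\<sigma> i' = 1" "i' \<le> n"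
      proof -
        have "0 \<in> \<sigma> ` {..n}" "1 \<in> \<sigma> ` {..n}"
          using n by (auto simp: permutes_image[OF \<sigma>])
        then show thesis
          by (auto intro: that)
      qed
      have "smooth_at (flag_coords n) (gen_ideal (flag_coords n) (set ?G)) (2 * n - 4) y"
      proof (rule smooth_at_if_independent)
        show "length ?G + (2 * n - 4) = card (flag_coords n)"
          by (simp add: card)
        fix c assume rel: "\<And>s. s \<in> flag_coords n \<Longrightarrow>
            (\<Sum>i<length ?G. c i * eval_at y (pdiff s (?G ! i))) = 0"
        have rel': "(\<Sum>k<3. c k * meval to_ac y (pdiff s (contact_coeff \<sigma> F k))) = 0"
          if "s \<in> flag_coords n" for s
          using rel[OF that] by (simp add: der)
        show "\<forall>l<length ?G. c l = 0"
        proof (rule ccontr)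
          assume "\<not> ?thesis"
          then obtain l where l: "l < 3" "c l \<noteq> 0" by auto
          have ne: "\<sigma> j \<noteq> 0" if "j \<noteq> i" for j
            using that i(1) inj by (metis injD)
          have ne': "\<sigma> j \<noteq> 1" if "j \<noteq> i'" for j
            using that i(3) inj by (metis injD)
          have le: "\<sigma> j \<le> n" if "j \<le> n" for j
            using that permutes_in_image[OF \<sigma>, of j] by simp
          have "\<exists>z. (\<exists>j\<le>n. z j \<noteq> 0) \<and> (\<forall>j\<le>n. meval to_ac z (pdiff j F) = 0)"
          proof (rule ac.singular_point_of_dependent_contact[OF F i(2,4), of "flag_point \<sigma> y" "flag_dir \<sigma> y"])
            show "flag_point \<sigma> y i = 1" "flag_dir \<sigma> y i = 0" "flag_dir \<sigma> y i' = 1"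
              using i by (auto simp: flag_point_def flag_dir_def)
            show "poly.coeff (line_restr to_ac (flag_point \<sigma> y) (flag_dir \<sigma> y) F) k = 0" if "k < 3" for k
              using zero that by (simp add: val)
            show "l < 3" "c l \<noteq> 0" by fact+
            show "(\<Sum>k<3. c k * poly.coeff (line_restr to_ac (flag_point \<sigma> y) (flag_dir \<sigma> y) (pdiff j F)) k) = 0"
              if "j \<le> n" "j \<noteq> i" for j
              using rel'[of "Xi (\<sigma> j)"] that ne[of j] le[of j]
              by (simp add: meval_pdiff_Xi_contact_coeff[OF poly inj] flag_coords_def)
            show "(\<Sum>k<3. c k * poly.coeff (pCons 0 (line_restr to_ac (flag_point \<sigma> y) (flag_dir \<sigma> y) (pdiff j F))) k) = 0"
              if "j \<le> n" "j \<noteq> i" "j \<noteq> i'" for j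
            proof -
              have "2 \<le> \<sigma> j" using ne[of j] ne'[of j] that by linarith
              then show ?thesis
                using rel'[of "Zeta (\<sigma> j)"] that le[of j]
                by (simp add: meval_pdiff_Zeta_contact_coeff[OF poly inj] flag_coords_def)
            qed
          qed
          then show False using nonsing by (simp add: singular_vector_def)
        qed
      qed
      moreover have "set ?G = e \<sigma> ` {..<3}"
        by (auto simp: atLeast0LessThan)
      ultimately show "smooth_at (flag_coords n) (gen_ideal (flag_coords n) (e \<sigma> ` {..<3})) (2 * n - 4) y"
        by simp
    qed
  qed
qed

theorem theorem3p5:
  fixes F :: "(nat, 'a::field) mpoly" and n :: nat
  assumes "CHAR('a) \<noteq> 3"
    and "n \<ge> 2"
    and "F \<in> forms n 3"
  shows "smooth_of_dim (2 * n - 4) (Y_charts n F 3) \<longleftrightarrow> smooth_of_dim (n - 1) (X_charts n F)"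
proof -
  have "\<not> CHAR('a) dvd 3"
  proof
    assume dvd: "CHAR('a) dvd 3"
    then have "CHAR('a) \<le> 3"
      by (rule dvd_imp_le) simp
    then have "CHAR('a) = 0 \<or> CHAR('a) = 1 \<or> CHAR('a) = 2 \<or> CHAR('a) = 3"
      by linarith
    then show False
      using dvd assms(1) CHAR_not_1'[where ?'a = 'a] by auto
  qed
  then have char: "of_nat 3 \<noteq> (0 :: 'a)"
    by (simp only: of_nat_eq_0_iff_char_dvd not_False_eq_True)
  have "smooth_of_dim (n - 1) (X_charts n F) \<longleftrightarrow> \<not> (\<exists>z. singular_vector n F z)"
    using smooth_hypersurface_iff[of F n 2] assms char by (simp add: numeral_3_eq_3 numeral_2_eq_2)
  then show ?thesis
    using smooth_contact_scheme_iff[OF assms(3) char assms(2)] by simp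
qed

end
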